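(* For any partition $\mu$, $$\prod_{i,\,j\geqslant 1}\frac{1-a_{i-\mu_i}\,y_j}{1-x_i\,y_j}\;s_\mu(x\|a)=\sum_{\nu}s_\nu(x\|a)\,\widehat s_{\nu/\mu}(y\|a),$$ summed over partitions $\nu$ containing $\mu$, where $\widehat s_{\nu/\mu}(y\|a)$ is the skew dual Schur function defined by the tableau formula in the context. In particular, for any partition (normal, i.e. nonskew, diagram) $\lambda$ the dual Schur function $\widehat s_\lambda(x\|a)$ (defined as a ratio of determinants) admits the tableau presentation $$\widehat s_{\lambda}(x\|a)=\sum_{T}\prod_{\alpha\in\lambda}X_{T(\alpha)}(a_{-c(\alpha)+1},a_{-c(\alpha)}),$$ summed over the reverse $\lambda$-tableaux $T$.
   Context: Let $a=(a_i)_{i\in\mathbb Z}$ be a sequence of commuting indeterminates and $\mathbb Q[a]$ the polynomial ring in the $a_i$. The ring $\Lambda(x\|a)$: its elements are sequences $P=(P_0,P_1,P_2,\dots)$, where $P_n$ is a symmetric polynomial in $x_1,\dots,x_n$ with coefficients in $\mathbb Q[a]$, the total degrees of the $P_n$ in the $x_i$ are bounded, and $P_n(x_1,\dots,x_{n-1},a_n)=P_{n-1}(x_1,\dots,x_{n-1})$ for all $n\geqslant 1$; multiplication is componentwise. Double Schur functions: for a partition $\lambda$ with length $\ell(\lambda)\leqslant n$, $$s_\lambda(x_1,\dots,x_n\|a)=\frac{\det\big[(x_i\|a)^{\lambda_j+n-j}\big]_{i,j=1}^n}{\prod_{1\leqslant i<j\leqslant n}(x_i-x_j)},\qquad (x_i\|a)^r=(x_i-a_n)(x_i-a_{n-1})\cdots(x_i-a_{n-r+1}),\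 (x_i\|a)^0=1,$$ and $s_\lambda(x_1,\dots,x_n\|a)=0$ if $\ell(\lambda)>n$. This sequence (over $n$) is $s_\lambda(x\|a)\in\Lambda(x\|a)$. Dual Schur functions (determinantal definition): let $\widehat\Lambda(x\|a)$ be the ring of formal (possibly infinite) sums $\sum_{\lambda}c_\lambda(a)s_\lambda(x)$, $c_\lambda(a)\in\mathbb Q[a]$, with $s_\lambda(x)$ the ordinary Schur functions. Let $d$ be the number of boxes on the main diagonal of $\lambda$. For $n\geqslant\ell(\lambda)$, $$\widehat s_\lambda(x_1,\dots,x_n\|a)=\frac{\det[A_{ij}]_{i,j=1}^n}{\prod_{1\leqslant i<j\leqslant n}(x_i-x_j)},$$ where $A_{ij}=\dfrac{x_i^{\lambda_j+n-j}}{(1-a_0x_i)(1-a_{-1}x_i)\cdots(1-a_{j-\lambda_j}x_i)}$ for $1\leqslant j\leqslant d$ and $A_{ij}=x_i^{\lambda_j+n-j}(1-a_1x_i)(1-a_2x_i)\cdots(1-a_{j-\lambda_j-1}x_i)$ for $d<j\leqslant n$; it is $0$ if $\ell(\lambda)>n$. These are compatible with setting $x_n=0$ and define $\widehat s_\lambda(x\|a)\in\widehat\Lambda(x\|a)$. Tableaux: for a (skew) diagram $\theta$, a reverse $\theta$-tableau is a filling $T$ of the boxes of $\theta$ with positive integers weakly decreasing along the rows and strictly decreasing down the columns; the content of the box $\alpha=(i,j)$ (row $i$, column $j$) is $c(\alpha)=j-i$. Put $$X_i(g,h)=\frac{x_i(1-g\,x_{i-1})\cdots(1-g\,x_1)}{(1-h\,x_i)\cdots(1-h\,x_1)}.$$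 The skew dual Schur function is the formal series $\widehat s_\theta(x\|a)=\sum_T\prod_{\alpha\in\theta}X_{T(\alpha)}(a_{-c(\alpha)+1},a_{-c(\alpha)})$ over the reverse $\theta$-tableaux $T$; $\widehat s_\theta(y\|a)$ is the same with $y$ in place of $x$. Meaning of the identity: for each $n\geqslant\ell(\mu)$ replace $x$ by $(x_1,\dots,x_n)$, with $i$ in the product running over $1,\dots,n$; this is an identity of formal power series in $y=(y_1,y_2,\dots)$. *)

theory Defs
  imports
    "HOL-Library.Poly_Mapping"
    "HOL-Library.FuncSet"
    "HOL-Computational_Algebra.Fraction_Field"
    "HOL-Analysis.Infinite_Sum"
    "HOL-Analysis.Infinite_Products"
    "Jordan_Normal_Form.Determinant"
begin

section \<open>Formal power series in the variables indexed by the natural numbers\<close>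

typedef 'a mfps = "UNIV :: ((nat \<Rightarrow>\<^sub>0 nat) \<Rightarrow> 'a) set"
  morphisms mcoeff Abs_mfps ..

setup_lifting type_definition_mfps

lemma mfps_eqI: "(\<And>m. mcoeff f m = mcoeff g m) \<Longrightarrow> f = g"
  by (simp add: mcoeff_inject[symmetric] fun_eq_iff)

definition splits :: "(nat \<Rightarrow>\<^sub>0 nat) \<Rightarrow> ((nat \<Rightarrow>\<^sub>0 nat) \<times> (nat \<Rightarrow>\<^sub>0 nat)) set" where
  "splits m = {(p, q). p + q = m}"

lemma finite_dominated:
  fixes m :: "nat \<Rightarrow>\<^sub>0 nat"
  shows "finite {p. \<forall>i. Poly_Mapping.lookup p i \<le> Poly_Mapping.lookup m i}" (is "finite ?S")
proof -
  let ?g = "\<lambda>p :: nat \<Rightarrow>\<^sub>0 nat. restrict (Poly_Mapping.lookup p) (Poly_Mapping.keys m)"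
  have "inj_on ?g ?S"
  proof (rule inj_onI)
    fix p q assume pq: "p \<in> ?S" "q \<in> ?S" "?g p = ?g q"
    have "Poly_Mapping.lookup p i = Poly_Mapping.lookup q i" for i
    proof (cases "i \<in> Poly_Mapping.keys m")
      case True
      then show ?thesis using fun_cong[OF pq(3), of i] by simp
    next
      case False
      then have "Poly_Mapping.lookup m i = 0" by (simp add: in_keys_iff)
      then show ?thesis using pq by (metis (mono_tags) le_zero_eq mem_Collect_eq)
    qed
    then show "p = q" by (simp add: poly_mapping_eqI)
  qed
  moreover have "?g ` ?S \<subseteq> Pi\<^sub>E (Poly_Mapping.keys m) (\<lambda>i. {..Poly_Mapping.lookup m i})" by auto
  moreover have "finite (Pi\<^sub>E (Poly_Mapping.keys m) (\<lambda>i. {..Poly_Mapping.lookup m i}))"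
    by (intro finite_PiE) auto
  ultimately show ?thesis by (meson finite_imageD finite_subset)
qed

lemma finite_splits [simp]: "finite (splits m)"
proof -
  have "splits m \<subseteq> {p. \<forall>i. Poly_Mapping.lookup p i \<le> Poly_Mapping.lookup m i} \<times>
      {p. \<forall>i. Poly_Mapping.lookup p i \<le> Poly_Mapping.lookup m i}"
    by (auto simp: splits_def lookup_add)
  then show ?thesis using finite_dominated finite_subset by blast
qed

lemma sum_splits_zero:
  "(\<Sum>(p, q)\<in>splits m. (if p = 0 then c else 0) * f q) = c * (f m :: 'a :: semiring_0)"
proof -
  have "(\<Sum>x\<in>splits m. (if fst x = 0 then c else 0) * f (snd x))
      = (\<Sum>x\<in>{(0 :: nat \<Rightarrow>\<^sub>0 nat, m)}. (if fst x = 0 then c else 0) * f (snd x))"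
  proof (rule sum.mono_neutral_right[OF finite_splits])
    show "\<forall>x\<in>splits m - {(0, m)}. (if fst x = 0 then c else 0) * f (snd x) = 0"
    proof
      fix x assume "x \<in> splits m - {(0, m)}"
      then have "x \<noteq> (0, m)" and "fst x + snd x = m" by (simp_all add: splits_def case_prod_unfold)
      then have "fst x \<noteq> 0" by (metis add_0 prod.collapse)
      then show "(if fst x = 0 then c else 0) * f (snd x) = 0" by simp
    qed
  qed (simp add: splits_def)
  then show ?thesis by (simp add: case_prod_unfold)
qed

instantiation mfps :: (zero) zero
begin
lift_definition zero_mfps :: "'a mfps" is "\<lambda>_. 0" .
instance ..
end

instantiation mfps :: (zero_neq_one) zero_neq_one
begin
lift_definition one_mfps :: "'a mfps" is "\<lambda>m. if m = 0 then 1 else 0" .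
instance by standard (transfer, metis zero_neq_one)
end

instantiation mfps :: (comm_ring_1) comm_ring_1
begin
lift_definition plus_mfps :: "'a mfps \<Rightarrow> 'a mfps \<Rightarrow> 'a mfps" is "\<lambda>f g m. f m + g m" .
lift_definition minus_mfps :: "'a mfps \<Rightarrow> 'a mfps \<Rightarrow> 'a mfps" is "\<lambda>f g m. f m - g m" .
lift_definition uminus_mfps :: "'a mfps \<Rightarrow> 'a mfps" is "\<lambda>f m. - f m" .
lift_definition times_mfps :: "'a mfps \<Rightarrow> 'a mfps \<Rightarrow> 'a mfps"
  is "\<lambda>f g m. \<Sum>(p, q)\<in>splits m. f p * g q" .
instance
proof
  fix f g h :: "'a mfps"
  show "f * g * h = f * (g * h)"
  proof (transfer, rule ext)
    fix f g h :: "(nat \<Rightarrow>\<^sub>0 nat) \<Rightarrow> 'a" and m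
    define i j :: "_ \<Rightarrow> ((nat \<Rightarrow>\<^sub>0 nat) \<times> (nat \<Rightarrow>\<^sub>0 nat)) \<times> ((nat \<Rightarrow>\<^sub>0 nat) \<times> (nat \<Rightarrow>\<^sub>0 nat))"
      where "i z = ((fst (fst z) + fst (snd z), snd (snd z)), (fst (fst z), fst (snd z)))"
        and "j z = ((fst (snd z), snd (snd z) + snd (fst z)), (snd (snd z), snd (fst z)))" for z
    have "(\<Sum>(p, q)\<in>splits m. (\<Sum>(r, s)\<in>splits p. f r * g s) * h q)
        = (\<Sum>x\<in>splits m. \<Sum>y\<in>splits (fst x). f (fst y) * g (snd y) * h (snd x))"
      by (simp add: case_prod_unfold sum_distrib_right)
    also have "\<dots> = (\<Sum>(x, y)\<in>(SIGMA x:splits m. splits (fst x)). f (fst y) * g (snd y) * h (snd x))"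
      by (rule sum.Sigma) auto
    also have "\<dots> = (\<Sum>(x, y)\<in>(SIGMA x:splits m. splits (snd x)). f (fst x) * (g (fst y) * h (snd y)))"
    proof (rule sum.reindex_bij_witness[where i = i and j = j])
      fix z assume "z \<in> (SIGMA x:splits m. splits (fst x))"
      then obtain r s q where z: "z = ((r + s, q), (r, s))" and m: "r + s + q = m"
        by (auto simp: splits_def)
      show "i (j z) = z" by (simp add: z i_def j_def)
      show "j z \<in> (SIGMA x:splits m. splits (snd x))"
        by (simp add: z j_def splits_def m flip: add.assoc)
      show "(case j z of (x, y) \<Rightarrow> f (fst x) * (g (fst y) * h (snd y))) =
          (case z of (x, y) \<Rightarrow> f (fst y) * g (snd y) * h (snd x))"
        by (simp add: z j_def mult.assoc)
    next
      fix z assume "z \<in> (SIGMA x:splits m. splits (snd x))"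
      then obtain p r s where z: "z = ((p, r + s), (r, s))" and m: "p + (r + s) = m"
        by (auto simp: splits_def)
      show "j (i z) = z" by (simp add: z i_def j_def)
      show "i z \<in> (SIGMA x:splits m. splits (fst x))"
        using m by (simp add: z i_def splits_def add.assoc)
    qed
    also have "\<dots> = (\<Sum>x\<in>splits m. \<Sum>y\<in>splits (snd x). f (fst x) * (g (fst y) * h (snd y)))"
      by (rule sum.Sigma[symmetric]) auto
    also have "\<dots> = (\<Sum>(p, q)\<in>splits m. f p * (\<Sum>(r, s)\<in>splits q. g r * h s))"
      by (simp add: case_prod_unfold sum_distrib_left)
    finally show "(\<Sum>(p, q)\<in>splits m. (\<Sum>(r, s)\<in>splits p. f r * g s) * h q)
        = (\<Sum>(p, q)\<in>splits m. f p * (\<Sum>(r, s)\<in>splits q. g r * h s))" .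
  qed
  show "f * g = g * f"
    by (transfer, rule ext,
        rule sum.reindex_bij_witness[where i = prod.swap and j = prod.swap])
      (auto simp: splits_def add.commute mult.commute)
  show "1 * f = f"
  proof (transfer, rule ext)
    fix f :: "(nat \<Rightarrow>\<^sub>0 nat) \<Rightarrow> 'a" and m
    show "(\<Sum>(p, q)\<in>splits m. (if p = 0 then 1 else 0) * f q) = f m"
      by (simp add: sum_splits_zero)
  qed
  show "f + g + h = f + (g + h)" by transfer (simp add: add.assoc)
  show "f + g = g + f" by transfer (simp add: add.commute)
  show "0 + f = f" by transfer simp
  show "- f + f = 0" by transfer simp
  show "f - g = f + - g" by transfer simp
  show "(f + g) * h = f * h + g * h"
    by transfer (simp add: case_prod_unfold distrib_right sum.distrib)
qed
end

definition mdeg :: "(nat \<Rightarrow>\<^sub>0 nat) \<Rightarrow> nat" where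
  "mdeg m = (\<Sum>i\<in>Poly_Mapping.keys m. Poly_Mapping.lookup m i)"

lemma mdeg_superset:
  "finite S \<Longrightarrow> Poly_Mapping.keys m \<subseteq> S \<Longrightarrow> mdeg m = (\<Sum>i\<in>S. Poly_Mapping.lookup m i)"
  unfolding mdeg_def by (rule sum.mono_neutral_left) (auto simp: in_keys_iff)

lemma keys_add_nat: "Poly_Mapping.keys (p + q) = Poly_Mapping.keys p \<union> Poly_Mapping.keys (q :: nat \<Rightarrow>\<^sub>0 nat)"
  by (auto simp: in_keys_iff lookup_add)

lemma mdeg_add: "mdeg (p + q) = mdeg p + mdeg q"
proof -
  let ?S = "Poly_Mapping.keys p \<union> Poly_Mapping.keys q"
  have "mdeg (p + q) = (\<Sum>i\<in>?S. Poly_Mapping.lookup (p + q) i)"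
    by (rule mdeg_superset) (auto simp: keys_add_nat)
  moreover have "mdeg p = (\<Sum>i\<in>?S. Poly_Mapping.lookup p i)" "mdeg q = (\<Sum>i\<in>?S. Poly_Mapping.lookup q i)"
    by (rule mdeg_superset; auto)+
  ultimately show ?thesis by (simp add: lookup_add sum.distrib)
qed

lemma finite_mdeg_keys: "finite {m. mdeg m = d \<and> Poly_Mapping.keys m \<subseteq> {..N}}"
proof -
  define b where "b = (\<Sum>i\<le>N. Poly_Mapping.single i d)"
  have "Poly_Mapping.lookup m i \<le> Poly_Mapping.lookup b i"
    if m: "mdeg m = d" "Poly_Mapping.keys m \<subseteq> {..N}" for m i
  proof (cases "i \<le> N")
    case True
    have "Poly_Mapping.lookup m i \<le> (\<Sum>i\<le>N. Poly_Mapping.lookup m i)"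
      by (rule member_le_sum) (use True in auto)
    also have "\<dots> = d" using mdeg_superset[of "{..N}" m] m by simp
    also have "d = Poly_Mapping.lookup b i"
      using True by (simp add: b_def lookup_sum lookup_single when_def)
    finally show ?thesis .
  next
    case False
    then have "Poly_Mapping.lookup m i = 0" using m(2) by (auto simp: in_keys_iff)
    then show ?thesis by simp
  qed
  then have "{m. mdeg m = d \<and> Poly_Mapping.keys m \<subseteq> {..N}}
      \<subseteq> {p. \<forall>i. Poly_Mapping.lookup p i \<le> Poly_Mapping.lookup b i}"
    by blast
  then show ?thesis using finite_dominated finite_subset by blast
qed

instance mfps :: (idom) idom
proof
  fix f g :: "'a mfps"
  assume fg: "f \<noteq> 0" "g \<noteq> 0"
  have ex: "\<exists>m. mcoeff h m \<noteq> 0" if "h \<noteq> 0" for h :: "'a mfps"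
    using that by (metis mfps_eqI zero_mfps.rep_eq)
  define D where "D h = (LEAST d. \<exists>m. mcoeff h m \<noteq> 0 \<and> mdeg m = d)" for h :: "'a mfps"
  have D: "\<exists>m. mcoeff h m \<noteq> 0 \<and> mdeg m = D h" if "h \<noteq> 0" for h
    unfolding D_def by (rule LeastI_ex) (use ex[OF that] in blast)
  have D_le: "D h \<le> mdeg m" if "mcoeff h m \<noteq> 0" for h m
    unfolding D_def by (rule Least_le) (use that in blast)
  obtain u v where u: "mcoeff f u \<noteq> 0" "mdeg u = D f" and v: "mcoeff g v \<noteq> 0" "mdeg v = D g"
    using D fg by metis
  obtain N where N: "Poly_Mapping.keys u \<union> Poly_Mapping.keys v \<subseteq> {..N}"
    using finite_nat_set_iff_bounded_le[of "Poly_Mapping.keys u \<union> Poly_Mapping.keys v"] by auto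
  define S where "S h = {m. mcoeff h m \<noteq> 0 \<and> mdeg m = D h \<and> Poly_Mapping.keys m \<subseteq> {..N}}" for h
  have fin: "finite (S h)" for h
    by (rule finite_subset[OF _ finite_mdeg_keys[of "D h" N]]) (auto simp: S_def)
  have ne: "S f \<noteq> {}" "S g \<noteq> {}" using u v N by (auto simp: S_def)
  define p q where "p = Min (S f)" and "q = Min (S g)"
  have p: "p \<in> S f" and q: "q \<in> S g" unfolding p_def q_def using fin ne Min_in by blast+
  have uniq: "p' = p \<and> q' = q"
    if pq: "p' + q' = p + q" "mcoeff f p' \<noteq> 0" "mcoeff g q' \<noteq> 0" for p' q'
  proof -
    have "Poly_Mapping.keys p' \<union> Poly_Mapping.keys q' = Poly_Mapping.keys p \<union> Poly_Mapping.keys q"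
      using pq(1) by (metis keys_add_nat)
    then have k: "Poly_Mapping.keys p' \<subseteq> {..N}" "Poly_Mapping.keys q' \<subseteq> {..N}"
      using p q by (auto simp: S_def)
    have "mdeg p' + mdeg q' = D f + D g"
      using mdeg_add[of p' q'] mdeg_add[of p q] pq(1) p q by (simp add: S_def)
    moreover have "D f \<le> mdeg p'" "D g \<le> mdeg q'" using pq D_le by auto
    ultimately have "p' \<in> S f" "q' \<in> S g" using k pq by (auto simp: S_def)
    then have le: "p \<le> p'" "q \<le> q'" by (auto simp: p_def q_def fin)
    show ?thesis
    proof (rule ccontr)
      assume "\<not> ?thesis"
      then have "p < p' \<or> q < q'" using le by auto
      then have "p + q < p' + q'"
        using add_less_le_mono[of p p' q q'] add_le_less_mono[of p p' q q'] le by auto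
      then show False using pq(1) by simp
    qed
  qed
  have "mcoeff (f * g) (p + q) = (\<Sum>x\<in>splits (p + q). mcoeff f (fst x) * mcoeff g (snd x))"
    by (simp add: times_mfps.rep_eq case_prod_unfold)
  also have "\<dots> = (\<Sum>x\<in>{(p, q)}. mcoeff f (fst x) * mcoeff g (snd x))"
  proof (rule sum.mono_neutral_right[OF finite_splits])
    show "{(p, q)} \<subseteq> splits (p + q)" by (simp add: splits_def)
    show "\<forall>x\<in>splits (p + q) - {(p, q)}. mcoeff f (fst x) * mcoeff g (snd x) = 0"
    proof
      fix x assume x: "x \<in> splits (p + q) - {(p, q)}"
      then have "fst x + snd x = p + q" unfolding splits_def by (simp add: case_prod_unfold)
      then have "mcoeff f (fst x) = 0 \<or> mcoeff g (snd x) = 0"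
        using uniq x by (metis Diff_iff insertI1 prod.collapse)
      then show "mcoeff f (fst x) * mcoeff g (snd x) = 0" by auto
    qed
  qed
  also have "\<dots> \<noteq> 0" using p q by (simp add: S_def)
  finally show "f * g \<noteq> 0" by (metis zero_mfps.rep_eq)
qed

text \<open>
  Division is multiplication by the multiplicative inverse in the ring of power series
  (and by \<open>0\<close> if there is none).
\<close>

instantiation mfps :: (comm_ring_1) inverse
begin
definition inverse_mfps :: "'a mfps \<Rightarrow> 'a mfps" where
  "inverse_mfps f = (if \<exists>g. f * g = 1 then THE g. f * g = 1 else 0)"
definition divide_mfps :: "'a mfps \<Rightarrow> 'a mfps \<Rightarrow> 'a mfps" where
  "divide_mfps f g = f * inverse g"
instance ..
end

lemma mfps_inverse_eqI:
  assumes "f * g = (1 :: 'a :: comm_ring_1 mfps)"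
  shows "inverse f = g"
proof -
  have unique: "h = g" if "f * h = 1" for h
  proof -
    have "h = h * (f * g)" by (simp add: assms)
    also have "\<dots> = (f * h) * g" by (simp only: mult_ac)
    also have "\<dots> = g" by (simp add: that)
    finally show ?thesis .
  qed
  have "(THE g. f * g = 1) = g" by (rule the_equality) (fact assms, fact unique)
  moreover have "\<exists>g. f * g = 1" using assms ..
  ultimately show ?thesis by (simp add: inverse_mfps_def)
qed

text \<open>The topology of coefficientwise convergence, the coefficients being discrete.\<close>

instantiation mfps :: (type) t2_space
begin
definition open_mfps :: "'a mfps set \<Rightarrow> bool" where
  "open_mfps U \<longleftrightarrow> (\<forall>f\<in>U. \<exists>M. finite M \<and> (\<forall>g. (\<forall>m\<in>M. mcoeff g m = mcoeff f m) \<longrightarrow> g \<in> U))"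
instance
proof
  show "open (UNIV :: 'a mfps set)" by (auto simp: open_mfps_def)
next
  fix S T :: "'a mfps set"
  assume ST: "open S" "open T"
  show "open (S \<inter> T)"
    unfolding open_mfps_def
  proof
    fix f assume "f \<in> S \<inter> T"
    then have f: "f \<in> S" "f \<in> T" by simp_all
    obtain M where M: "finite M" "\<forall>g. (\<forall>m\<in>M. mcoeff g m = mcoeff f m) \<longrightarrow> g \<in> S"
      using ST(1) f(1) unfolding open_mfps_def by blast
    obtain N where N: "finite N" "\<forall>g. (\<forall>m\<in>N. mcoeff g m = mcoeff f m) \<longrightarrow> g \<in> T"
      using ST(2) f(2) unfolding open_mfps_def by blast
    from M N show "\<exists>M. finite M \<and> (\<forall>g. (\<forall>m\<in>M. mcoeff g m = mcoeff f m) \<longrightarrow> g \<in> S \<inter> T)"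
      by (intro exI[of _ "M \<union> N"]) auto
  qed
next
  fix K :: "'a mfps set set"
  assume K: "\<forall>S\<in>K. open S"
  show "open (\<Union>K)"
    unfolding open_mfps_def
  proof
    fix f assume "f \<in> \<Union>K"
    then obtain S where S: "S \<in> K" "f \<in> S" by blast
    then have "open S" using K by blast
    then obtain M where "finite M" "\<forall>g. (\<forall>m\<in>M. mcoeff g m = mcoeff f m) \<longrightarrow> g \<in> S"
      using S(2) unfolding open_mfps_def by blast
    then show "\<exists>M. finite M \<and> (\<forall>g. (\<forall>m\<in>M. mcoeff g m = mcoeff f m) \<longrightarrow> g \<in> \<Union>K)"
      using S(1) by blast
  qed
next
  fix f g :: "'a mfps"
  assume "f \<noteq> g"
  then obtain m where m: "mcoeff f m \<noteq> mcoeff g m" using mfps_eqI[of f g] by blast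
  have "open {h. mcoeff h m = c}" for c :: 'a
    unfolding open_mfps_def by (auto intro!: exI[of _ "{m}"])
  then have "open {h. mcoeff h m = mcoeff f m}" "open {h. mcoeff h m = mcoeff g m}" by blast+
  moreover have "{h. mcoeff h m = mcoeff f m} \<inter> {h. mcoeff h m = mcoeff g m} = {}" using m by auto
  ultimately show "\<exists>U V. open U \<and> open V \<and> f \<in> U \<and> g \<in> V \<and> U \<inter> V = {}" by blast
qed
end

lemma mcoeff_sum: "mcoeff (\<Sum>t\<in>A. f t) m = (\<Sum>t\<in>A. mcoeff (f t :: 'a :: comm_ring_1 mfps) m)"
  by (induction A rule: infinite_finite_induct) (simp_all add: zero_mfps.rep_eq plus_mfps.rep_eq)

lemma mfps_summableI:
  fixes f :: "'b \<Rightarrow> 'a :: comm_ring_1 mfps"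
  assumes fin: "\<And>m. finite {t \<in> A. mcoeff (f t) m \<noteq> 0}"
  shows "f summable_on A"
proof -
  define s where "s = Abs_mfps (\<lambda>m. \<Sum>t\<in>{t \<in> A. mcoeff (f t) m \<noteq> 0}. mcoeff (f t) m)"
  have s: "mcoeff s m = (\<Sum>t\<in>{t \<in> A. mcoeff (f t) m \<noteq> 0}. mcoeff (f t) m)" for m
    by (simp add: s_def Abs_mfps_inverse)
  have "(f has_sum s) A"
    unfolding has_sum_def
  proof (rule topological_tendstoI)
    fix U assume "open U" "s \<in> U"
    then obtain M where M: "finite M" "\<forall>g. (\<forall>m\<in>M. mcoeff g m = mcoeff s m) \<longrightarrow> g \<in> U"
      unfolding open_mfps_def by blast
    define X where "X = (\<Union>m\<in>M. {t \<in> A. mcoeff (f t) m \<noteq> 0})"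
    have X: "finite X" "X \<subseteq> A" unfolding X_def using M(1) fin by auto
    have "sum f Y \<in> U" if Y: "finite Y" "X \<subseteq> Y" "Y \<subseteq> A" for Y
    proof -
      have "mcoeff (sum f Y) m = mcoeff s m" if m: "m \<in> M" for m
        unfolding mcoeff_sum s
        by (rule sum.mono_neutral_right) (use Y m in \<open>auto simp: X_def\<close>)
      then show ?thesis using M(2) by blast
    qed
    then show "\<forall>\<^sub>F Y in finite_subsets_at_top A. sum f Y \<in> U"
      unfolding eventually_finite_subsets_at_top using X by blast
  qed
  then show ?thesis unfolding summable_on_def by blast
qed

text \<open>
  Variables of power series are numbered from 1 below; the variable with index 0 exists in the
  type but does not occur in any of the series considered.
\<close>

lift_definition mconst :: "'a :: zero \<Rightarrow> 'a mfps" is "\<lambda>c m. if m = 0 then c else 0" .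

lift_definition mvar :: "nat \<Rightarrow> 'a :: zero_neq_one mfps"
  is "\<lambda>k m. if m = Poly_Mapping.single k 1 then 1 else 0" .

text \<open>Set all variables with index greater than \<open>n\<close> to zero.\<close>

lift_definition truncate_vars :: "nat \<Rightarrow> 'a :: zero mfps \<Rightarrow> 'a mfps"
  is "\<lambda>n f m. if Poly_Mapping.keys m \<subseteq> {..n} then f m else 0" .


text \<open>Every factor \<open>1 - c x\<^sub>k\<close> is invertible, the inverse being the geometric series.\<close>

lift_definition mgeom :: "'a :: comm_ring_1 \<Rightarrow> nat \<Rightarrow> 'a mfps"
  is "\<lambda>c k m. if Poly_Mapping.keys m \<subseteq> {k} then c ^ Poly_Mapping.lookup m k else 0" .

lemma mcoeff_const_mult: "mcoeff (mconst c * f) m = c * mcoeff f m"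
  by (simp add: times_mfps.rep_eq mconst.rep_eq sum_splits_zero)

lemma mcoeff_var_mult:
  "mcoeff (mvar k * f) m =
    (if Poly_Mapping.lookup m k = 0 then 0 else mcoeff f (m - Poly_Mapping.single k 1))"
proof -
  let ?e = "Poly_Mapping.single k (1 :: nat)"
  have "mcoeff (mvar k * f) m =
      (\<Sum>x\<in>splits m. (if fst x = ?e then 1 else 0) * mcoeff f (snd x))"
    by (simp add: times_mfps.rep_eq mvar.rep_eq case_prod_unfold)
  also have "\<dots> = (\<Sum>x\<in>{x \<in> splits m. fst x = ?e}. mcoeff f (snd x))"
    by (rule sum.mono_neutral_cong_right) simp_all
  also have "{x \<in> splits m. fst x = ?e} =
      (if Poly_Mapping.lookup m k = 0 then {} else {(?e, m - ?e)})"
  proof (cases "Poly_Mapping.lookup m k = 0")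
    case True
    have "fst x \<noteq> ?e" if x: "x \<in> splits m" for x
    proof
      assume e: "fst x = ?e"
      have "fst x + snd x = m" using x by (simp add: splits_def case_prod_unfold)
      then have "Poly_Mapping.lookup m k = Poly_Mapping.lookup ?e k + Poly_Mapping.lookup (snd x) k"
        unfolding e by (metis lookup_add)
      then show False using True by simp
    qed
    then have "{x \<in> splits m. fst x = ?e} = {}" by blast
    then show ?thesis using True by simp
  next
    case False
    have m: "?e + (m - ?e) = m"
    proof (rule poly_mapping_eqI)
      fix i
      show "Poly_Mapping.lookup (?e + (m - ?e)) i = Poly_Mapping.lookup m i"
        using False by (cases "i = k") (simp_all add: lookup_add lookup_minus lookup_single)
    qed
    have "x \<in> splits m \<and> fst x = ?e \<longleftrightarrow> x = (?e, m - ?e)" for x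
    proof
      assume x: "x \<in> splits m \<and> fst x = ?e"
      then have "?e + snd x = m" by (auto simp: splits_def)
      then have "snd x = m - ?e" by (metis add_diff_cancel_left')
      then show "x = (?e, m - ?e)" using x by (metis prod.collapse)
    next
      assume "x = (?e, m - ?e)"
      then show "x \<in> splits m \<and> fst x = ?e" using m by (simp add: splits_def)
    qed
    then have "{x \<in> splits m. fst x = ?e} = {(?e, m - ?e)}" by blast
    then show ?thesis using False by simp
  qed
  finally show ?thesis by (cases "Poly_Mapping.lookup m k = 0") simp_all
qed

lemma mgeom_eq: "(1 - mconst c * mvar k) * mgeom c k = 1"
proof (rule mfps_eqI)
  fix m :: "nat \<Rightarrow>\<^sub>0 nat"
  let ?e = "Poly_Mapping.single k (1 :: nat)"
  let ?K = "Poly_Mapping.keys m \<subseteq> {k}"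
  have "mcoeff ((1 - mconst c * mvar k) * mgeom c k) m =
      mcoeff (mgeom c k) m - c * mcoeff (mvar k * mgeom c k) m"
    by (simp add: left_diff_distrib minus_mfps.rep_eq mult.assoc mcoeff_const_mult)
  also have "\<dots> = mcoeff 1 m"
  proof (cases "Poly_Mapping.lookup m k = 0")
    case True
    then have "k \<notin> Poly_Mapping.keys m" by (simp add: in_keys_iff)
    then have "?K \<longleftrightarrow> Poly_Mapping.keys m = {}" by (simp add: subset_singleton_iff) auto
    then have "?K \<longleftrightarrow> m = 0" by simp
    then show ?thesis using True by (simp add: mcoeff_var_mult mgeom.rep_eq one_mfps.rep_eq)
  next
    case False
    have m: "m \<noteq> 0"
    proof
      assume "m = 0"
      then show False using False by simp
    qed
    obtain r where r: "Poly_Mapping.lookup m k = Suc r"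
      using False by (cases "Poly_Mapping.lookup m k") simp_all
    have r': "Poly_Mapping.lookup (m - ?e) k = r" by (simp add: lookup_minus r)
    have "i \<in> Poly_Mapping.keys (m - ?e) \<longleftrightarrow> i \<in> Poly_Mapping.keys m" if "i \<noteq> k" for i
      using that by (simp add: in_keys_iff lookup_minus lookup_single)
    then have K: "Poly_Mapping.keys (m - ?e) \<subseteq> {k} \<longleftrightarrow> ?K"
      unfolding subset_iff by (metis singletonI singletonD)
    have "mcoeff (mgeom c k) m = c * mcoeff (mgeom c k) (m - ?e)"
    proof (cases ?K)
      case True
      then show ?thesis using K by (simp only: mgeom.rep_eq r r' if_True power_Suc)
    next
      case False
      then show ?thesis using K by (simp only: mgeom.rep_eq if_False mult_zero_right)
    qed
    then show ?thesis
      using False m by (simp add: mcoeff_var_mult one_mfps.rep_eq del: One_nat_def)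
  qed
  finally show "mcoeff ((1 - mconst c * mvar k) * mgeom c k) m = mcoeff 1 m" .
qed

lemma inverse_one_minus_var: "inverse (1 - mconst c * mvar k) = mgeom c k"
  by (rule mfps_inverse_eqI) (rule mgeom_eq)

lemma truncate_vars_inject:
  assumes "\<And>n. truncate_vars n f = truncate_vars n g"
  shows "f = g"
proof (rule mfps_eqI)
  fix m :: "nat \<Rightarrow>\<^sub>0 nat"
  obtain n where n: "Poly_Mapping.keys m \<subseteq> {..n}"
    using finite_nat_set_iff_bounded_le[of "Poly_Mapping.keys m"] by auto
  have "mcoeff (truncate_vars n f) m = mcoeff (truncate_vars n g) m" using assms by simp
  then show "mcoeff f m = mcoeff g m" using n by (simp add: truncate_vars.rep_eq)
qed


section \<open>Partitions, diagrams and tableaux\<close>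

text \<open>
  A partition is the weakly decreasing list of its nonzero parts, so that its length is
  \<open>length lam\<close>; parts are numbered from 1, and \<open>part lam i = 0\<close> beyond the length.
\<close>

definition is_partition :: "nat list \<Rightarrow> bool" where
  "is_partition lam \<longleftrightarrow> sorted_wrt (\<ge>) lam \<and> 0 \<notin> set lam"

definition part :: "nat list \<Rightarrow> nat \<Rightarrow> nat" where
  "part lam i = (if 1 \<le> i \<and> i \<le> length lam then lam ! (i - 1) else 0)"

definition diagram :: "nat list \<Rightarrow> (nat \<times> nat) set" where
  "diagram lam = {(i, j). 1 \<le> i \<and> 1 \<le> j \<and> j \<le> part lam i}"

lemma finite_diagram: "finite (diagram lam)"
proof (rule finite_subset)
  show "diagram lam \<subseteq> {..length lam} \<times> {..sum_list lam}"
  proof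
    fix b assume "b \<in> diagram lam"
    then obtain i j where b: "b = (i, j)" "1 \<le> j" "j \<le> part lam i"
      unfolding diagram_def by blast
    then have i: "1 \<le> i" "i \<le> length lam" by (auto simp: part_def split: if_splits)
    then have "part lam i \<le> sum_list lam" unfolding part_def by (simp add: elem_le_sum_list)
    then show "b \<in> {..length lam} \<times> {..sum_list lam}" using b i by simp
  qed
qed simp

definition content :: "nat \<times> nat \<Rightarrow> int" where
  "content b = int (snd b) - int (fst b)"

definition diagonal :: "nat list \<Rightarrow> nat" where
  "diagonal lam = card {i. (i, i) \<in> diagram lam}"

text \<open>
  Fillings are extensional functions, so each filling of \<open>\<theta>\<close> occurs exactly once.
\<close>

definition reverse_tableaux :: "(nat \<times> nat) set \<Rightarrow> (nat \<times> nat \<Rightarrow> nat) set" where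
  "reverse_tableaux \<theta> = {T \<in> \<theta> \<rightarrow>\<^sub>E {1..}.
     (\<forall>i j j'. (i, j) \<in> \<theta> \<and> (i, j') \<in> \<theta> \<and> j < j' \<longrightarrow> T (i, j') \<le> T (i, j)) \<and>
     (\<forall>i i' j. (i, j) \<in> \<theta> \<and> (i', j) \<in> \<theta> \<and> i < i' \<longrightarrow> T (i', j) < T (i, j))}"


section \<open>Determinants of matrices with rows and columns numbered from 1\<close>

definition det1 :: "nat \<Rightarrow> (nat \<Rightarrow> nat \<Rightarrow> 'a :: comm_ring_1) \<Rightarrow> 'a" where
  "det1 n A = Determinant.det (Matrix.mat n n (\<lambda>(i, j). A (Suc i) (Suc j)))"

definition vandermonde :: "nat \<Rightarrow> (nat \<Rightarrow> 'a :: comm_ring_1) \<Rightarrow> 'a" where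
  "vandermonde n x = (\<Prod>i\<in>{1..n}. \<Prod>j\<in>{i<..n}. x i - x j)"


section \<open>Double Schur functions\<close>

definition double_power :: "(int \<Rightarrow> 'k :: comm_ring_1) \<Rightarrow> nat \<Rightarrow> 'k \<Rightarrow> nat \<Rightarrow> 'k" where
  "double_power a n z r = (\<Prod>k<r. z - a (int n - int k))"

definition double_schur ::
  "(int \<Rightarrow> 'k :: field) \<Rightarrow> nat \<Rightarrow> (nat \<Rightarrow> 'k) \<Rightarrow> nat list \<Rightarrow> 'k" where
  "double_schur a n x lam =
    (if length lam \<le> n
     then det1 n (\<lambda>i j. double_power a n (x i) (part lam j + n - j)) / vandermonde n x
     else 0)"


section \<open>Dual Schur functions\<close>

definition tableau_factor :: "nat \<Rightarrow> 'r \<Rightarrow> 'r \<Rightarrow> 'r :: comm_ring_1 mfps" where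
  "tableau_factor i g h =
    mvar i * (\<Prod>k\<in>{1..<i}. 1 - mconst g * mvar k) / (\<Prod>k\<in>{1..i}. 1 - mconst h * mvar k)"

definition tableau_weight ::
  "(int \<Rightarrow> 'r :: comm_ring_1) \<Rightarrow> (nat \<times> nat) set \<Rightarrow> (nat \<times> nat \<Rightarrow> nat) \<Rightarrow> 'r mfps" where
  "tableau_weight a \<theta> T =
    (\<Prod>b\<in>\<theta>. tableau_factor (T b) (a (- content b + 1)) (a (- content b)))"

lemma tableau_weight_summable:
  assumes "finite \<theta>"
  shows "tableau_weight a \<theta> summable_on reverse_tableaux \<theta>"
proof (rule mfps_summableI)
  fix m :: "nat \<Rightarrow>\<^sub>0 nat"
  let ?S = "{T \<in> reverse_tableaux \<theta>. mcoeff (tableau_weight a \<theta> T) m \<noteq> 0}"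
  have "T b \<in> Poly_Mapping.keys m" if T: "mcoeff (tableau_weight a \<theta> T) m \<noteq> 0" and b: "b \<in> \<theta>"
    for T b
  proof -
    define p where "p b = tableau_factor (T b) (a (- content b + 1)) (a (- content b))" for b
    define u where "u = (\<Prod>k\<in>{1..<T b}. 1 - mconst (a (- content b + 1)) * mvar k) *
      inverse (\<Prod>k\<in>{1..T b}. 1 - mconst (a (- content b)) * mvar k)"
    have "tableau_weight a \<theta> T = p b * prod p (\<theta> - {b})"
      unfolding tableau_weight_def p_def[symmetric] using assms b by (rule prod.remove)
    also have "p b = mvar (T b) * u"
      unfolding p_def u_def tableau_factor_def divide_mfps_def by (rule mult.assoc)
    finally have "tableau_weight a \<theta> T = mvar (T b) * (u * prod p (\<theta> - {b}))"
      unfolding mult.assoc .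
    then have "Poly_Mapping.lookup m (T b) \<noteq> 0"
      using T mcoeff_var_mult[of "T b" "u * prod p (\<theta> - {b})" m] by presburger
    then show ?thesis by (simp only: in_keys_iff not_False_eq_True)
  qed
  then have "T \<in> \<theta> \<rightarrow>\<^sub>E Poly_Mapping.keys m" if "T \<in> ?S" for T
    using that unfolding reverse_tableaux_def mem_Collect_eq PiE_iff by blast
  then have "?S \<subseteq> \<theta> \<rightarrow>\<^sub>E Poly_Mapping.keys m" by blast
  moreover have "finite (\<theta> \<rightarrow>\<^sub>E Poly_Mapping.keys m)" using assms by (intro finite_PiE) simp_all
  ultimately show "finite ?S" by (rule finite_subset)
qed

text \<open>The sum converges for finite \<open>\<theta>\<close> by \<open>tableau_weight_summable\<close>.\<close>

definition skew_dual_schur ::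
  "(int \<Rightarrow> 'r :: comm_ring_1) \<Rightarrow> (nat \<times> nat) set \<Rightarrow> 'r mfps" where
  "skew_dual_schur a \<theta> = (\<Sum>\<^sub>\<infinity>T\<in>reverse_tableaux \<theta>. tableau_weight a \<theta> T)"

definition dual_entry ::
  "(int \<Rightarrow> 'r :: comm_ring_1) \<Rightarrow> nat \<Rightarrow> nat list \<Rightarrow> nat \<Rightarrow> nat \<Rightarrow> 'r mfps" where
  "dual_entry a n lam i j =
    (if j \<le> diagonal lam
     then mvar i ^ (part lam j + n - j) /
       (\<Prod>k\<in>{int j - int (part lam j)..0}. 1 - mconst (a k) * mvar i)
     else mvar i ^ (part lam j + n - j) *
       (\<Prod>k\<in>{1..int j - int (part lam j) - 1}. 1 - mconst (a k) * mvar i))"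

text \<open>
  The quotient of determinants is formed in the field of fractions of the ring of power series.
\<close>

definition dual_schur_fin ::
  "(int \<Rightarrow> 'r :: idom) \<Rightarrow> nat \<Rightarrow> nat list \<Rightarrow> 'r mfps fract" where
  "dual_schur_fin a n lam =
    (if length lam \<le> n
     then to_fract (det1 n (dual_entry a n lam)) / to_fract (vandermonde n mvar)
     else 0)"

text \<open>
  The series in infinitely many variables given by the compatible sequence of the quotients
  above, as an element of the ring of power series of which the formal sums of Schur functions
  form a subring. It is determined uniquely by the sequence, see \<open>truncate_vars_inject\<close>.
\<close>

definition dual_schur :: "(int \<Rightarrow> 'r :: idom) \<Rightarrow> nat list \<Rightarrow> 'r mfps" where
  "dual_schur a lam = (THE f. \<forall>n. to_fract (truncate_vars n f) = dual_schur_fin a n lam)"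


section \<open>Indeterminates\<close>

type_synonym Qa = "(int \<Rightarrow>\<^sub>0 nat) \<Rightarrow>\<^sub>0 rat"
type_synonym Qax = "(nat \<Rightarrow>\<^sub>0 nat) \<Rightarrow>\<^sub>0 Qa"

definition pvar :: "'v \<Rightarrow> ('v \<Rightarrow>\<^sub>0 nat) \<Rightarrow>\<^sub>0 'r :: zero_neq_one" where
  "pvar v = Poly_Mapping.single (Poly_Mapping.single v 1) 1"

definition avar :: "int \<Rightarrow> Qa" where
  "avar = pvar"

text \<open>The same indeterminates, and the \<open>x\<^sub>i\<close>, in the field of fractions of \<open>\<rat>[a][x]\<close>.\<close>

definition avar_frac :: "int \<Rightarrow> Qax fract" where
  "avar_frac k = to_fract (Poly_Mapping.single 0 (avar k))"

definition xvar_frac :: "nat \<Rightarrow> Qax fract" where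
  "xvar_frac i = to_fract (pvar i)"

end

theory Submission
  imports Defs
begin

text \<open>
  Both identities are proved one variable at a time. The boxes of a reverse tableau with the
  largest (smallest) entry form an inner (outer) horizontal strip, and the factors
  \<open>(1 - g x\<^sub>l) / (1 - h x\<^sub>l)\<close> of the weights of the boxes of \<open>\<nu>/\<mu>\<close> telescope along the \<open>i\<close>-th row to
  \<open>(1 - a\<^bsub>i - \<mu>\<^sub>i\<^esub> x\<^sub>l) / (1 - a\<^bsub>i - \<nu>\<^sub>i\<^esub> x\<^sub>l)\<close>.

  For the dual Schur function, subtracting from each column of the determinant a multiple of the
  next one clears the first row up to its last entry; the remaining minor expands into a sum
  over the interlacing shapes, which is the removal of the entries 1 from the tableaux.

  For the Cauchy identity in one variable \<open>y\<close>, the function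
  \<open>g\<^sub>r = (x\<parallel>a)\<^sup>r (1 - a\<^bsub>n-r\<^esub> y) / (1 - x y)\<close> satisfies
  \<open>g\<^sub>r = (x\<parallel>a)\<^sup>r + y / (1 - a\<^bsub>n-r-1\<^esub> y) g\<^bsub>r+1\<^esub>\<close>, so that column operations turn
  \<open>det [g\<^sub>r(x\<^sub>i)]\<close>, \<open>r = \<mu>\<^sub>j + n - j\<close>, into a sum over the shapes differing from \<open>\<mu>\<close> by a horizontal
  strip. Several variables follow by removing the largest entry from the tableaux. Bounding the
  first parts by \<open>K\<close> keeps all sums finite, at the price of an error of degree growing with \<open>K\<close>.
\<close>

section \<open>Determinants\<close>

text \<open>The permutation acts on the row indices, so each summand is a product over columns,
  which the expansions below split.\<close>

lemma det1_leibniz: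
  "det1 n A = (\<Sum>p | p permutes {0..<n}. signof p * (\<Prod>j\<in>{1..n}. A (Suc (p (j - 1))) j))"
proof -
  have "(\<Prod>j<n. Matrix.mat n n (\<lambda>(i, j). A (Suc i) (Suc j)) $$ (p j, j)) =
      (\<Prod>j\<in>{1..n}. A (Suc (p (j - 1))) j)" if p: "p permutes {0..<n}" for p
  proof -
    have "(\<Prod>j<n. Matrix.mat n n (\<lambda>(i, j). A (Suc i) (Suc j)) $$ (p j, j)) =
        (\<Prod>j<n. A (Suc (p j)) (Suc j))"
      using permutes_in_image[OF p] by (intro prod.cong) auto
    also have "\<dots> = (\<Prod>j\<in>{1..n}. A (Suc (p (j - 1))) j)"
      by (rule prod.reindex_bij_witness[of _ "\<lambda>j. j - 1" Suc]) auto
    finally show ?thesis .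
  qed
  then show ?thesis
    unfolding det1_def by (subst det_col[of _ n]) (auto intro!: sum.cong)
qed

lemma det1_cong:
  assumes "\<And>i j. 1 \<le> i \<Longrightarrow> i \<le> n \<Longrightarrow> 1 \<le> j \<Longrightarrow> j \<le> n \<Longrightarrow> A i j = B i j"
  shows "det1 n A = det1 n B"
  unfolding det1_def by (rule arg_cong[where f = Determinant.det], rule eq_matI) (auto intro: assms)

text \<open>Multilinearity in all columns at once: \<open>f\<close> picks one summand per column.
  Later \<open>S j\<close> is an interval of lengths for row j, so that the choice functions are
  themselves shapes.\<close>

lemma det1_sum_columns:
  fixes c :: "nat \<Rightarrow> 's \<Rightarrow> 'a :: comm_ring_1"
  assumes "\<And>j. 1 \<le> j \<Longrightarrow> j \<le> n \<Longrightarrow> finite (S j)"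
  shows "det1 n (\<lambda>i j. \<Sum>s\<in>S j. c j s * B i j s) =
    (\<Sum>f\<in>PiE {1..n} S. (\<Prod>j\<in>{1..n}. c j (f j)) * det1 n (\<lambda>i j. B i j (f j)))"
proof -
  let ?P = "{p. p permutes {0..<n}}"
  let ?F = "PiE {1..n} S"
  have "det1 n (\<lambda>i j. \<Sum>s\<in>S j. c j s * B i j s) =
      (\<Sum>p\<in>?P. signof p * (\<Sum>f\<in>?F. \<Prod>j\<in>{1..n}. c j (f j) * B (Suc (p (j - 1))) j (f j)))"
    unfolding det1_leibniz by (subst prod_sum_PiE) (auto simp: assms)
  also have "\<dots> = (\<Sum>p\<in>?P. \<Sum>f\<in>?F.
      (\<Prod>j\<in>{1..n}. c j (f j)) * (signof p * (\<Prod>j\<in>{1..n}. B (Suc (p (j - 1))) j (f j))))"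
    by (simp add: sum_distrib_left prod.distrib mult_ac)
  also have "\<dots> = (\<Sum>f\<in>?F. \<Sum>p\<in>?P.
      (\<Prod>j\<in>{1..n}. c j (f j)) * (signof p * (\<Prod>j\<in>{1..n}. B (Suc (p (j - 1))) j (f j))))"
    by (rule sum.swap)
  finally show ?thesis by (simp add: det1_leibniz sum_distrib_left)
qed

text \<open>Scalings and column operations below are obtained as products with triangular
  matrices.\<close>

lemma det1_mult:
  "det1 n (\<lambda>i j. \<Sum>k\<in>{1..n}. A i k * U k j) = det1 n A * (det1 n U :: 'a :: comm_ring_1)"
proof -
  let ?M = "\<lambda>A. Matrix.mat n n (\<lambda>(i, j). A (Suc i) (Suc j) :: 'a)"
  have "?M (\<lambda>i j. \<Sum>k\<in>{1..n}. A i k * U k j) = ?M A * ?M U"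
  proof (rule eq_matI)
    fix i j assume "i < dim_row (?M A * ?M U)" "j < dim_col (?M A * ?M U)"
    then have ij: "i < n" "j < n" by auto
    have "(\<Sum>k\<in>{1..n}. A (Suc i) k * U k (Suc j)) = (\<Sum>k\<in>{0..<n}. A (Suc i) (Suc k) * U (Suc k) (Suc j))"
      by (rule sum.reindex_bij_witness[of _ Suc "\<lambda>j. j - 1"]) auto
    then show "?M (\<lambda>i j. \<Sum>k\<in>{1..n}. A i k * U k j) $$ (i, j) = (?M A * ?M U) $$ (i, j)"
      using ij by (simp add: scalar_prod_def)
  qed auto
  then show ?thesis unfolding det1_def by (simp add: det_mult[of _ n])
qed

lemma det1_upper_triangular:
  assumes "\<And>i j. j < i \<Longrightarrow> A i j = 0"
  shows "det1 n A = (\<Prod>i\<in>{1..n}. A i i)"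
proof -
  have "det1 n A = (\<Prod>i\<in>{0..<n}. A (Suc i) (Suc i))"
    unfolding det1_def
    by (subst det_upper_triangular[of _ n])
      (auto simp: assms prod_list_diag_prod upper_triangular_def)
  also have "\<dots> = (\<Prod>i\<in>{1..n}. A i i)"
    by (rule prod.reindex_bij_witness[of _ "\<lambda>j. j - 1" Suc]) auto
  finally show ?thesis .
qed

lemma det1_lower_triangular:
  assumes "\<And>i j. i < j \<Longrightarrow> A i j = 0"
  shows "det1 n A = (\<Prod>i\<in>{1..n}. A i i)"
proof -
  have "det1 n A = (\<Prod>i\<in>{0..<n}. A (Suc i) (Suc i))"
    unfolding det1_def
    by (subst det_lower_triangular[of n]) (auto simp: assms prod_list_diag_prod)
  also have "\<dots> = (\<Prod>i\<in>{1..n}. A i i)"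
    by (rule prod.reindex_bij_witness[of _ "\<lambda>j. j - 1" Suc]) auto
  finally show ?thesis .
qed

lemma det1_scale_rows: "det1 n (\<lambda>i j. r i * A i j) = (\<Prod>i\<in>{1..n}. r i) * det1 n A"
proof -
  have "det1 n (\<lambda>i j. r i * A i j) =
      det1 n (\<lambda>i j. \<Sum>k\<in>{1..n}. (if i = k then r i else 0) * A k j)"
    by (rule det1_cong) (simp add: if_distrib[of "\<lambda>x. x * _"] cong: if_cong)
  also have "\<dots> = det1 n (\<lambda>i k. if i = k then r i else 0) * det1 n A"
    by (rule det1_mult)
  finally show ?thesis by (simp add: det1_upper_triangular)
qed

lemma det1_add_first_column:
  assumes "1 \<le> n"
  shows "det1 n (\<lambda>i j. A i j + (if j = 1 then s * b i else 0)) =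
    det1 n A + s * det1 n (\<lambda>i j. if j = 1 then b i else A i j)"
proof -
  have split: "(\<Prod>j\<in>{1..n}. g j) = g 1 * (\<Prod>j\<in>{1<..n}. g j)" for g :: "nat \<Rightarrow> 'a"
  proof -
    have "{1..n} = insert 1 {1<..n}" using assms by auto
    then show ?thesis by simp
  qed
  have "(\<Prod>j\<in>{1<..n}. B (p (j - 1)) j + (if j = 1 then s * c (p (j - 1)) else 0)) = (\<Prod>j\<in>{1<..n}. B (p (j - 1)) j)"
    "(\<Prod>j\<in>{1<..n}. if j = 1 then c (p (j - 1)) else B (p (j - 1)) j) = (\<Prod>j\<in>{1<..n}. B (p (j - 1)) j)"
    for p :: "nat \<Rightarrow> nat" and B c by (auto intro!: prod.cong)
  note rest = this[where B = "\<lambda>i. A (Suc i)" and c = "\<lambda>i. b (Suc i)"]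
  show ?thesis
    unfolding det1_leibniz split rest
    by (simp add: sum_distrib_left sum.distrib algebra_simps)
qed

lemma det1_scale_columns: "det1 n (\<lambda>i j. r j * A i j) = (\<Prod>j\<in>{1..n}. r j) * det1 n A"
proof -
  have "det1 n (\<lambda>i j. r j * A i j) =
      det1 n (\<lambda>i j. \<Sum>k\<in>{1..n}. A i k * (if k = j then r j else 0))"
    by (rule det1_cong) (simp add: if_distrib[of "\<lambda>x. _ * x"] mult.commute cong: if_cong)
  also have "\<dots> = det1 n A * det1 n (\<lambda>k j. if k = j then r j else 0)"
    by (rule det1_mult)
  finally show ?thesis by (simp add: det1_upper_triangular mult.commute)
qed

text \<open>All columns change simultaneously, each by its old left neighbour; this is right
  multiplication by a unipotent bidiagonal matrix.\<close>

lemma det1_add_column_left: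
  "det1 n (\<lambda>i j. A i j - (if j = 1 then 0 else c j * A i (j - 1))) = det1 n A"
proof -
  let ?U = "\<lambda>k j. if k = j then 1 else if Suc k = j then - c j else 0"
  have "det1 n (\<lambda>i j. A i j - (if j = 1 then 0 else c j * A i (j - 1))) =
      det1 n (\<lambda>i j. \<Sum>k\<in>{1..n}. A i k * ?U k j)"
  proof (rule det1_cong)
    fix i j assume ij: "1 \<le> i" "i \<le> n" "1 \<le> j" "j \<le> n"
    have "(\<Sum>k\<in>{1..n}. A i k * ?U k j) =
        (\<Sum>k\<in>{1..n}. (if k = j then A i j else 0) - (if k = j - 1 then c j * A i (j - 1) else 0))"
      using ij by (intro sum.cong) (auto simp: mult.commute)
    also have "\<dots> = A i j - (if j = 1 then 0 else c j * A i (j - 1))"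
      using ij by (auto simp: sum_subtractf)
    finally show "A i j - (if j = 1 then 0 else c j * A i (j - 1)) = (\<Sum>k\<in>{1..n}. A i k * ?U k j)"
      by simp
  qed
  also have "\<dots> = det1 n A * det1 n ?U" by (rule det1_mult)
  also have "det1 n ?U = 1" by (subst det1_upper_triangular) auto
  finally show ?thesis by simp
qed

lemma det1_add_column_right:
  "det1 n (\<lambda>i j. A i j - (if j = n then 0 else c j * A i (Suc j))) = det1 n A"
proof -
  let ?U = "\<lambda>k j. if k = j then 1 else if k = Suc j then - c j else 0"
  have "det1 n (\<lambda>i j. A i j - (if j = n then 0 else c j * A i (Suc j))) =
      det1 n (\<lambda>i j. \<Sum>k\<in>{1..n}. A i k * ?U k j)"
  proof (rule det1_cong)
    fix i j assume ij: "1 \<le> i" "i \<le> n" "1 \<le> j" "j \<le> n"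
    have "(\<Sum>k\<in>{1..n}. A i k * ?U k j) =
        (\<Sum>k\<in>{1..n}. (if k = j then A i j else 0) - (if k = Suc j then c j * A i (Suc j) else 0))"
      using ij by (intro sum.cong) (auto simp: mult.commute)
    also have "\<dots> = A i j - (if j = n then 0 else c j * A i (Suc j))"
      using ij by (auto simp: sum_subtractf)
    finally show "A i j - (if j = n then 0 else c j * A i (Suc j)) = (\<Sum>k\<in>{1..n}. A i k * ?U k j)"
      by simp
  qed
  also have "\<dots> = det1 n A * det1 n ?U" by (rule det1_mult)
  also have "det1 n ?U = 1" by (subst det1_lower_triangular) auto
  finally show ?thesis by simp
qed

lemma det1_expand_row:
  assumes "\<And>j. 1 \<le> j \<Longrightarrow> j \<le> n \<Longrightarrow> A 1 j = 0"
  shows "det1 (Suc n) A = (- 1) ^ n * A 1 (Suc n) * det1 n (\<lambda>i j. A (Suc i) j)"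
proof -
  let ?M = "Matrix.mat (Suc n) (Suc n) (\<lambda>(i, j). A (Suc i) (Suc j))"
  have "det1 (Suc n) A = (\<Sum>j<Suc n. ?M $$ (0, j) * cofactor ?M 0 j)"
    unfolding det1_def by (rule laplace_expansion_row) auto
  also have "\<dots> = A 1 (Suc n) * cofactor ?M 0 n"
    using assms by simp
  also have "mat_delete ?M 0 n = Matrix.mat n n (\<lambda>(i, j). A (Suc (Suc i)) (Suc j))"
    by (rule eq_matI) (auto simp: mat_delete_def)
  then have "cofactor ?M 0 n = (- 1) ^ n * det1 n (\<lambda>i j. A (Suc i) j)"
    by (simp add: cofactor_def det1_def)
  finally show ?thesis by (simp add: mult_ac)
qed

section \<open>Reverse tableaux and horizontal strips\<close>

text \<open>Prescribing the set \<open>A\<close> of entries makes it possible to cut a tableau by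
  the values of its entries.\<close>

definition tableaux :: "(nat \<times> nat) set \<Rightarrow> nat set \<Rightarrow> (nat \<times> nat \<Rightarrow> nat) set" where
  "tableaux \<theta> A = {T \<in> \<theta> \<rightarrow>\<^sub>E A.
     (\<forall>i j j'. (i, j) \<in> \<theta> \<and> (i, j') \<in> \<theta> \<and> j < j' \<longrightarrow> T (i, j') \<le> T (i, j)) \<and>
     (\<forall>i i' j. (i, j) \<in> \<theta> \<and> (i', j) \<in> \<theta> \<and> i < i' \<longrightarrow> T (i', j) < T (i, j))}"

lemma reverse_tableaux_eq: "reverse_tableaux \<theta> = tableaux \<theta> {1..}"
  by (simp add: reverse_tableaux_def tableaux_def)

lemma tableauxI:
  assumes "T \<in> \<theta> \<rightarrow>\<^sub>E A"
    and "\<And>i j j'. (i, j) \<in> \<theta> \<Longrightarrow> (i, j') \<in> \<theta> \<Longrightarrow> j < j' \<Longrightarrow> T (i, j') \<le> T (i, j)"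
    and "\<And>i i' j. (i, j) \<in> \<theta> \<Longrightarrow> (i', j) \<in> \<theta> \<Longrightarrow> i < i' \<Longrightarrow> T (i', j) < T (i, j)"
  shows "T \<in> tableaux \<theta> A"
  using assms by (auto simp: tableaux_def)

lemma tableauxD:
  assumes "T \<in> tableaux \<theta> A"
  shows "T \<in> \<theta> \<rightarrow>\<^sub>E A"
    and "\<And>i j j'. (i, j) \<in> \<theta> \<Longrightarrow> (i, j') \<in> \<theta> \<Longrightarrow> j < j' \<Longrightarrow> T (i, j') \<le> T (i, j)"
    and "\<And>i i' j. (i, j) \<in> \<theta> \<Longrightarrow> (i', j) \<in> \<theta> \<Longrightarrow> i < i' \<Longrightarrow> T (i', j) < T (i, j)"
  using assms by (auto simp: tableaux_def)

lemma finite_tableaux: "finite \<theta> \<Longrightarrow> finite A \<Longrightarrow> finite (tableaux \<theta> A)"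
  by (rule finite_subset[of _ "\<theta> \<rightarrow>\<^sub>E A"]) (auto simp: tableaux_def intro: finite_PiE)

definition tableau_sum ::
  "(nat \<Rightarrow> nat \<times> nat \<Rightarrow> 'a :: comm_ring_1) \<Rightarrow> (nat \<times> nat) set \<Rightarrow> nat set \<Rightarrow> 'a" where
  "tableau_sum w \<theta> A = (\<Sum>T\<in>tableaux \<theta> A. \<Prod>b\<in>\<theta>. w (T b) b)"

text \<open>Order ideals of \<open>\<theta>\<close>: large entries of a reverse tableau lie towards
  the upper left, so the boxes with entries above a threshold form such a set.\<close>

definition lower_subsets :: "(nat \<times> nat) set \<Rightarrow> (nat \<times> nat) set set" where
  "lower_subsets \<theta> = {U. U \<subseteq> \<theta> \<and>
     (\<forall>i j j'. (i, j') \<in> U \<and> (i, j) \<in> \<theta> \<and> j < j' \<longrightarrow> (i, j) \<in> U) \<and>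
     (\<forall>i i' j. (i', j) \<in> U \<and> (i, j) \<in> \<theta> \<and> i < i' \<longrightarrow> (i, j) \<in> U)}"

lemma lower_subsetsI:
  assumes "U \<subseteq> \<theta>"
    and "\<And>i j j'. (i, j') \<in> U \<Longrightarrow> (i, j) \<in> \<theta> \<Longrightarrow> j < j' \<Longrightarrow> (i, j) \<in> U"
    and "\<And>i i' j. (i', j) \<in> U \<Longrightarrow> (i, j) \<in> \<theta> \<Longrightarrow> i < i' \<Longrightarrow> (i, j) \<in> U"
  shows "U \<in> lower_subsets \<theta>"
  using assms unfolding lower_subsets_def by blast

lemma lower_subsetsD:
  assumes "U \<in> lower_subsets \<theta>"
  shows "U \<subseteq> \<theta>"
    and "\<And>i j j'. (i, j') \<in> U \<Longrightarrow> (i, j) \<in> \<theta> \<Longrightarrow> j < j' \<Longrightarrow> (i, j) \<in> U"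
    and "\<And>i i' j. (i', j) \<in> U \<Longrightarrow> (i, j) \<in> \<theta> \<Longrightarrow> i < i' \<Longrightarrow> (i, j) \<in> U"
  using assms unfolding lower_subsets_def by blast+

text \<open>Cutting a tableau along the set of boxes with entries in \<open>A\<close> and gluing the
  two pieces are mutually inverse, and the weight is a product over boxes.\<close>

lemma tableau_sum_Un:
  assumes fin: "finite \<theta>" "finite A" "finite B" and less: "\<And>a b. a \<in> A \<Longrightarrow> b \<in> B \<Longrightarrow> b < a"
  shows "tableau_sum w \<theta> (A \<union> B) =
    (\<Sum>U\<in>lower_subsets \<theta>. tableau_sum w U A * tableau_sum w (\<theta> - U) B)"
proof -
  define j where "j T = (let U = {b \<in> \<theta>. T b \<in> A} in (U, restrict T U, restrict T (\<theta> - U)))"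
    for T :: "nat \<times> nat \<Rightarrow> nat"
  define i where "i = (\<lambda>(U :: (nat \<times> nat) set, T1, T2 :: nat \<times> nat \<Rightarrow> nat).
    restrict (\<lambda>b. if b \<in> U then T1 b else T2 b) \<theta>)"
  let ?S = "SIGMA U:lower_subsets \<theta>. tableaux U A \<times> tableaux (\<theta> - U) B"
  have lf: "finite (lower_subsets \<theta>)"
    by (rule finite_subset[of _ "Pow \<theta>"]) (use fin in \<open>auto simp: lower_subsets_def\<close>)
  have sub: "U \<subseteq> \<theta>" if "U \<in> lower_subsets \<theta>" for U
    using that by (auto simp: lower_subsets_def)
  have "tableau_sum w \<theta> (A \<union> B) =
      (\<Sum>(U, T1, T2)\<in>?S. (\<Prod>b\<in>U. w (T1 b) b) * (\<Prod>b\<in>\<theta> - U. w (T2 b) b))"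
    unfolding tableau_sum_def
  proof (rule sum.reindex_bij_witness[where i = i and j = j])
    fix T assume T: "T \<in> tableaux \<theta> (A \<union> B)"
    note T' = tableauxD[OF T]
    let ?U = "{b \<in> \<theta>. T b \<in> A}"
    have B: "T b \<in> B" if "b \<in> \<theta>" "T b \<notin> A" for b
      using that T'(1) by (auto simp: PiE_iff)
    have "T b = undefined" if "b \<notin> \<theta>" for b
      using T'(1) that by (rule PiE_arb)
    then show "i (j T) = T"
      unfolding i_def j_def by (auto simp: Let_def fun_eq_iff)
    have "?U \<in> lower_subsets \<theta>"
    proof (rule lower_subsetsI)
      fix i j j' assume *: "(i, j') \<in> ?U" "(i, j) \<in> \<theta>" "j < j'"
      then have "T (i, j') \<le> T (i, j)" using T'(2) by blast
      then show "(i, j) \<in> ?U" using * B[of "(i, j)"] less[of "T (i, j')" "T (i, j)"] by auto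
    next
      fix i i' j assume *: "(i', j) \<in> ?U" "(i, j) \<in> \<theta>" "i < i'"
      then have "T (i', j) < T (i, j)" using T'(3) by blast
      then show "(i, j) \<in> ?U" using * B[of "(i, j)"] less[of "T (i', j)" "T (i, j)"] by auto
    qed auto
    moreover have "restrict T ?U \<in> tableaux ?U A"
      using T' by (intro tableauxI) auto
    moreover have "restrict T (\<theta> - ?U) \<in> tableaux (\<theta> - ?U) B"
      using T' B by (intro tableauxI) auto
    ultimately show "j T \<in> ?S" by (simp add: j_def Let_def)
    have "(\<Prod>b\<in>\<theta>. w (T b) b) = (\<Prod>b\<in>?U. w (T b) b) * (\<Prod>b\<in>\<theta> - ?U. w (T b) b)"
      by (subst mult.commute, rule prod.subset_diff) (use fin in auto)
    then show "(case j T of (U, T1, T2) \<Rightarrow> (\<Prod>b\<in>U. w (T1 b) b) * (\<Prod>b\<in>\<theta> - U. w (T2 b) b)) =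
        (\<Prod>b\<in>\<theta>. w (T b) b)"
      by (simp add: j_def Let_def)
  next
    fix z assume "z \<in> ?S"
    then obtain U T1 T2 where z: "z = (U, T1, T2)" and U: "U \<in> lower_subsets \<theta>"
      and T1: "T1 \<in> tableaux U A" and T2: "T2 \<in> tableaux (\<theta> - U) B"
      by auto
    note T1' = tableauxD[OF T1] and T2' = tableauxD[OF T2]
    have A: "T1 b \<in> A" if "b \<in> U" for b using T1' that by auto
    have B: "T2 b \<in> B" if "b \<in> \<theta>" "b \<notin> U" for b using T2' that by auto
    have notA: "T2 b \<notin> A" if "b \<in> \<theta>" "b \<notin> U" for b using B[OF that] less by blast
    have undef: "T1 b = undefined" if "b \<notin> U" for b using T1'(1) that by (rule PiE_arb)
    have undef': "T2 b = undefined" if "b \<notin> \<theta> - U" for b using T2'(1) that by (rule PiE_arb)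
    have "{b \<in> \<theta>. i z b \<in> A} = U"
      using A notA sub[OF U] by (auto simp: i_def z)
    moreover have "restrict (i z) U = T1"
    proof
      fix b show "restrict (i z) U b = T1 b"
        using sub[OF U] undef[of b] by (cases "b \<in> U") (auto simp: i_def z)
    qed
    moreover have "restrict (i z) (\<theta> - U) = T2"
      by (rule ext) (use undef' in \<open>auto simp: i_def z\<close>)
    ultimately have "j (i z) = (U, T1, T2)" by (simp add: j_def)
    then show "j (i z) = z" by (simp add: z)
    show "i z \<in> tableaux \<theta> (A \<union> B)"
    proof (rule tableauxI)
      show "i z \<in> \<theta> \<rightarrow>\<^sub>E A \<union> B" using A B by (auto simp: i_def z)
    next
      fix i1 j1 j1' assume b: "(i1, j1) \<in> \<theta>" "(i1, j1') \<in> \<theta>" "j1 < j1'"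
      show "i z (i1, j1') \<le> i z (i1, j1)"
      proof (cases "(i1, j1') \<in> U")
        case True
        then have "(i1, j1) \<in> U" using lower_subsetsD[OF U] b by blast
        then show ?thesis using True b T1'(2) by (simp add: i_def z)
      next
        case False
        \<comment> \<open>The right-hand box has its entry in \<open>B\<close>; the box to its left
          either lies in \<open>U\<close>, with an entry from \<open>A\<close> and hence larger, or
          belongs to the same piece.\<close>
        then show ?thesis using b T2'(2) A[of "(i1, j1)"] B[of "(i1, j1')"]
          by (auto simp: i_def z less order_less_imp_le)
      qed
    next
      fix i1 i1' j1 assume b: "(i1, j1) \<in> \<theta>" "(i1', j1) \<in> \<theta>" "i1 < i1'"
      show "i z (i1', j1) < i z (i1, j1)"
      proof (cases "(i1', j1) \<in> U")
        case True
        then have "(i1, j1) \<in> U" using lower_subsetsD[OF U] b by blast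
        then show ?thesis using True b T1'(3) by (simp add: i_def z)
      next
        case False
        then show ?thesis using b T2'(3) A[of "(i1, j1)"] B[of "(i1', j1)"]
          by (auto simp: i_def z less)
      qed
    qed
  qed
  also have "\<dots> = (\<Sum>U\<in>lower_subsets \<theta>. \<Sum>(T1, T2)\<in>tableaux U A \<times> tableaux (\<theta> - U) B.
      (\<Prod>b\<in>U. w (T1 b) b) * (\<Prod>b\<in>\<theta> - U. w (T2 b) b))"
  proof (subst sum.Sigma[OF lf])
    show "\<forall>U\<in>lower_subsets \<theta>. finite (tableaux U A \<times> tableaux (\<theta> - U) B)"
      using fin finite_subset[OF sub fin(1)]
      by (auto intro!: finite_cartesian_product finite_tableaux)
  qed (auto intro!: sum.cong)
  also have "\<dots> = (\<Sum>U\<in>lower_subsets \<theta>. tableau_sum w U A * tableau_sum w (\<theta> - U) B)"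
    unfolding tableau_sum_def by (simp add: sum_product sum.cartesian_product)
  finally show ?thesis .
qed

section \<open>Shapes with a fixed number of rows\<close>

definition shape :: "nat \<Rightarrow> (nat \<Rightarrow> nat) \<Rightarrow> (nat \<times> nat) set" where
  "shape n f = (SIGMA i:{1..n}. {1..f i})"

definition decreasing :: "nat \<Rightarrow> (nat \<Rightarrow> nat) \<Rightarrow> bool" where
  "decreasing n f \<longleftrightarrow> (\<forall>i j. 1 \<le> i \<and> i \<le> j \<and> j \<le> n \<longrightarrow> f j \<le> f i)"

definition shapes_between :: "nat \<Rightarrow> (nat \<Rightarrow> nat) \<Rightarrow> (nat \<Rightarrow> nat) \<Rightarrow> (nat \<Rightarrow> nat) set" where
  "shapes_between n f g = {h \<in> PiE {1..n} (\<lambda>i. {f i..g i}). decreasing n h}"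

lemma finite_shape [simp]: "finite (shape n f)"
  by (simp add: shape_def)

lemma shape_cong: "(\<And>i. 1 \<le> i \<Longrightarrow> i \<le> n \<Longrightarrow> f i = g i) \<Longrightarrow> shape n f = shape n g"
  by (auto simp: shape_def)

lemma finite_shapes_between [simp]: "finite (shapes_between n f g)"
  by (rule finite_subset[of _ "PiE {1..n} (\<lambda>i. {f i..g i})"])
    (auto simp: shapes_between_def intro: finite_PiE)

lemma decreasingI:
  assumes "\<And>i. 1 \<le> i \<Longrightarrow> i < n \<Longrightarrow> f (Suc i) \<le> f i"
  shows "decreasing n f"
  unfolding decreasing_def
proof (intro allI impI)
  fix i j assume "1 \<le> i \<and> i \<le> j \<and> j \<le> n"
  then have "i \<le> j" "1 \<le> i" "j \<le> n" by auto
  then show "f j \<le> f i"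
  proof (induction j rule: dec_induct)
    case (step m)
    then have "f (Suc m) \<le> f m" by (intro assms) auto
    then show ?case using step by auto
  qed simp
qed

lemma shape_diff: "shape n g - shape n f = (SIGMA i:{1..n}. {f i<..g i})"
  by (auto simp: shape_def)

text \<open>An order ideal meets each row of the skew shape in an initial segment, so the ends of
  these segments determine it; closure along columns makes the ends decrease.\<close>

lemma bij_betw_lower_subsets:
  assumes f: "decreasing n f" and g: "decreasing n g"
    and le: "\<And>i. 1 \<le> i \<Longrightarrow> i \<le> n \<Longrightarrow> f i \<le> g i"
  shows "bij_betw (\<lambda>h. shape n h - shape n f) (shapes_between n f g)
    (lower_subsets (shape n g - shape n f))"
proof (rule bij_betwI')
  fix h h' assume h: "h \<in> shapes_between n f g" "h' \<in> shapes_between n f g"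
  show "shape n h - shape n f = shape n h' - shape n f \<longleftrightarrow> h = h'"
  proof
    assume eq: "shape n h - shape n f = shape n h' - shape n f"
    have "h i = h' i" if i: "i \<in> {1..n}" for i
    proof -
      have *: "f i < j \<and> j \<le> h i \<longleftrightarrow> f i < j \<and> j \<le> h' i" for j
        using eq i unfolding shape_diff by (auto simp: set_eq_iff)
      have "f i \<le> h i" "f i \<le> h' i" using h i by (auto simp: shapes_between_def PiE_iff)
      then show ?thesis using *[of "h i"] *[of "h' i"] by linarith
    qed
    then show "h = h'" using h by (intro PiE_ext[of h "{1..n}" _ h']) (auto simp: shapes_between_def)
  qed simp
next
  fix h assume h: "h \<in> shapes_between n f g"
  then have hb: "h i \<le> g i" "f i \<le> h i" if "1 \<le> i" "i \<le> n" for i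
    using that by (auto simp: shapes_between_def PiE_iff)
  show "shape n h - shape n f \<in> lower_subsets (shape n g - shape n f)"
    unfolding shape_diff
  proof (rule lower_subsetsI)
    show "(SIGMA i:{1..n}. {f i<..h i}) \<subseteq> (SIGMA i:{1..n}. {f i<..g i})"
    proof
      fix b assume "b \<in> (SIGMA i:{1..n}. {f i<..h i})"
      then show "b \<in> (SIGMA i:{1..n}. {f i<..g i})" using hb(1)[of "fst b"] by auto
    qed
  next
    fix i i' j
    assume *: "(i', j) \<in> (SIGMA i:{1..n}. {f i<..h i})" "(i, j) \<in> (SIGMA i:{1..n}. {f i<..g i})" "i < i'"
    then have "h i' \<le> h i" using h by (auto simp: shapes_between_def decreasing_def)
    then show "(i, j) \<in> (SIGMA i:{1..n}. {f i<..h i})" using * by auto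
  qed auto
next
  fix U assume U: "U \<in> lower_subsets (shape n g - shape n f)"
  \<comment> \<open>The end of the segment in row i; \<open>f i\<close> is the value for a row
    without boxes of \<open>U\<close>.\<close>
  define h where "h = restrict (\<lambda>i. Max (insert (f i) {j. (i, j) \<in> U})) {1..n}"
  note U' = lower_subsetsD[OF U[unfolded shape_diff]]
  have sub: "1 \<le> i \<and> i \<le> n \<and> f i < j \<and> j \<le> g i" if "(i, j) \<in> U" for i j
    using U'(1) that by auto
  have row: "(i, j) \<in> U" if "(i, j') \<in> U" "j \<le> j'" "f i < j" for i j j'
  proof (cases "j = j'")
    case False
    then show ?thesis using that sub[of i j'] by (intro U'(2)[of i j' j]) auto
  qed (use that in simp)
  have fin: "finite (insert (f i) {j. (i, j) \<in> U})" for i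
    by (rule finite_subset[of _ "{f i..f i + g i}"]) (auto dest: sub)
  have mem: "(i, j) \<in> U \<longleftrightarrow> 1 \<le> i \<and> i \<le> n \<and> f i < j \<and> j \<le> h i" for i j
  proof
    assume "(i, j) \<in> U"
    then show "1 \<le> i \<and> i \<le> n \<and> f i < j \<and> j \<le> h i"
      using sub[of i j] fin[of i] by (auto simp: h_def intro: Max_ge)
  next
    assume *: "1 \<le> i \<and> i \<le> n \<and> f i < j \<and> j \<le> h i"
    then have "h i \<in> insert (f i) {j. (i, j) \<in> U}"
      using Max_in[OF fin[of i]] by (auto simp: h_def)
    then show "(i, j) \<in> U" using * row by auto
  qed
  have hb: "f i \<le> h i \<and> h i \<le> g i" if "1 \<le> i" "i \<le> n" for i
    using that fin[of i] sub le by (auto simp: h_def intro: Max_ge)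
  have "decreasing n h"
  proof (rule decreasingI)
    fix i assume i: "1 \<le> i" "i < n"
    show "h (Suc i) \<le> h i"
    proof (rule ccontr)
      \<comment> \<open>If row i + 1 ended further right than row i, its last box would have
        directly above it a box of the skew shape outside \<open>U\<close>, against closure
        upwards.\<close>
      assume less: "\<not> h (Suc i) \<le> h i"
      have "f (Suc i) \<le> f i" "g (Suc i) \<le> g i" using f g i by (auto simp: decreasing_def)
      then have "f (Suc i) < h (Suc i)" "h (Suc i) \<le> g i" "f i < h (Suc i)"
        using hb[of i] hb[of "Suc i"] less i by auto
      moreover from this have "(Suc i, h (Suc i)) \<in> U" using i by (auto simp: mem)
      ultimately have "(i, h (Suc i)) \<in> U"
        using i by (intro U'(3)[of "Suc i" _ i]) auto
      then show False using less by (simp add: mem)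
    qed
  qed
  then have "h \<in> shapes_between n f g"
    using hb by (auto simp: shapes_between_def PiE_iff h_def)
  moreover have "U = shape n h - shape n f"
    unfolding shape_diff using mem by auto
  ultimately show "\<exists>h\<in>shapes_between n f g. U = shape n h - shape n f" by blast
qed

lemma tableau_sum_shape_Un:
  assumes "decreasing n f" "decreasing n g" "\<And>i. 1 \<le> i \<Longrightarrow> i \<le> n \<Longrightarrow> f i \<le> g i"
    and "finite A" "finite B" "\<And>a b. a \<in> A \<Longrightarrow> b \<in> B \<Longrightarrow> b < a"
  shows "tableau_sum w (shape n g - shape n f) (A \<union> B) =
    (\<Sum>h\<in>shapes_between n f g. tableau_sum w (shape n h - shape n f) A *
      tableau_sum w (shape n g - shape n h) B)"
proof -
  have "shape n g - shape n f - (shape n h - shape n f) = shape n g - shape n h"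
    if "h \<in> shapes_between n f g" for h
    using that unfolding shape_def shapes_between_def PiE_iff by fastforce
  then show ?thesis
    using assms
    by (subst tableau_sum_Un)
      (auto simp: sum.reindex_bij_betw[OF bij_betw_lower_subsets, symmetric])
qed

lemma tableau_sum_empty: "tableau_sum w {} A = 1"
proof -
  have "tableaux {} A = {\<lambda>_. undefined}" by (auto simp: tableaux_def)
  then show ?thesis by (simp add: tableau_sum_def)
qed

lemma tableau_sum_no_values: "\<theta> \<noteq> {} \<Longrightarrow> tableau_sum w \<theta> {} = 0"
proof -
  assume "\<theta> \<noteq> {}"
  then have "tableaux \<theta> {} = {}" by (auto simp: tableaux_def)
  then show ?thesis by (simp add: tableau_sum_def)
qed

text \<open>For decreasing \<open>f\<close> and \<open>g\<close> this says that no column contains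
  two boxes of the difference; row 1 is unconstrained.\<close>

definition horizontal_strip :: "nat \<Rightarrow> (nat \<Rightarrow> nat) \<Rightarrow> (nat \<Rightarrow> nat) \<Rightarrow> bool" where
  "horizontal_strip n f g \<longleftrightarrow> (\<forall>i. 1 \<le> i \<and> i < n \<longrightarrow> g (Suc i) \<le> f i)"

text \<open>Entries decrease strictly down columns, so the constant filling is a tableau exactly
  when no column has two boxes.\<close>

lemma tableau_sum_singleton:
  assumes f: "decreasing n f" and g: "decreasing n g"
  shows "tableau_sum w (shape n g - shape n f) {k} =
    (if horizontal_strip n f g then \<Prod>i\<in>{1..n}. \<Prod>j\<in>{f i<..g i}. w k (i, j) else 0)"
proof -
  let ?\<theta> = "shape n g - shape n f"
  have PiE: "T \<in> ?\<theta> \<rightarrow>\<^sub>E {k} \<longleftrightarrow> T = restrict (\<lambda>_. k) ?\<theta>" for T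
    by (auto simp: PiE_iff extensional_def fun_eq_iff)
  show ?thesis
  proof (cases "horizontal_strip n f g")
    case True
    have no_col: False if b: "(i, j) \<in> ?\<theta>" "(i', j) \<in> ?\<theta>" "i < i'" for i i' j
    proof -
      have ij: "1 \<le> i" "i < i'" "i' \<le> n" "f i < j" "j \<le> g i'" using b by (auto simp: shape_diff)
      then have "g i' \<le> g (Suc i)" using g by (auto simp: decreasing_def)
      also have "\<dots> \<le> f i" using True ij by (auto simp: horizontal_strip_def)
      finally show False using ij by simp
    qed
    have "tableaux ?\<theta> {k} = {restrict (\<lambda>_. k) ?\<theta>}"
    proof (intro equalityI subsetI)
      fix T assume "T \<in> tableaux ?\<theta> {k}"
      then show "T \<in> {restrict (\<lambda>_. k) ?\<theta>}" using tableauxD(1) PiE by blast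
    next
      fix T assume "T \<in> {restrict (\<lambda>_. k) ?\<theta>}"
      then have T: "T = restrict (\<lambda>_. k) ?\<theta>" by simp
      show "T \<in> tableaux ?\<theta> {k}"
      proof (rule tableauxI)
        show "T \<in> ?\<theta> \<rightarrow>\<^sub>E {k}" using T PiE by blast
      qed (use no_col T in auto)
    qed
    then have "tableau_sum w ?\<theta> {k} = (\<Prod>b\<in>?\<theta>. w k b)"
      by (simp add: tableau_sum_def)
    also have "\<dots> = (\<Prod>i\<in>{1..n}. \<Prod>j\<in>{f i<..g i}. w k (i, j))"
      unfolding shape_diff by (subst prod.Sigma) auto
    finally show ?thesis using True by simp
  next
    case False
    then obtain i where i: "1 \<le> i" "i < n" "f i < g (Suc i)"
      unfolding horizontal_strip_def by force
    \<comment> \<open>Where the strip condition fails, the boxes of rows i and i + 1 in column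
      \<open>g (Suc i)\<close> both lie in the difference and would carry the same entry.\<close>
    have "g (Suc i) \<le> g i" "f (Suc i) \<le> f i" using i f g by (auto simp: decreasing_def)
    then have b: "(i, g (Suc i)) \<in> ?\<theta>" "(Suc i, g (Suc i)) \<in> ?\<theta>"
      using i by (auto simp: shape_diff)
    have "tableaux ?\<theta> {k} = {}"
    proof (rule equals0I)
      fix T assume T: "T \<in> tableaux ?\<theta> {k}"
      have "T (Suc i, g (Suc i)) < T (i, g (Suc i))" using tableauxD(3)[OF T b] by simp
      moreover have "T = restrict (\<lambda>_. k) ?\<theta>" using tableauxD(1)[OF T] PiE by blast
      ultimately show False using b by simp
    qed
    then show ?thesis using False by (simp add: tableau_sum_def)
  qed
qed

text \<open>The first column meets all \<open>n\<close> rows and its entries are pairwise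
  distinct.\<close>

lemma tableaux_few_values:
  assumes "finite A" "card A < n" "1 \<le> f n" and f: "decreasing n f"
  shows "tableaux (shape n f) A = {}"
proof (rule equals0I)
  fix T assume T: "T \<in> tableaux (shape n f) A"
  have b: "(i, 1) \<in> shape n f" if "i \<in> {1..n}" for i
  proof -
    have "f n \<le> f i" using f that by (auto simp: decreasing_def)
    then show ?thesis using that assms by (auto simp: shape_def)
  qed
  have "inj_on (\<lambda>i. T (i, 1)) {1..n}"
  proof (rule linorder_inj_onI)
    fix i i' assume "i < i'" "i \<in> {1..n}" "i' \<in> {1..n}"
    then show "T (i, 1) \<noteq> T (i', 1)" using tableauxD(3)[OF T b b, of i i'] by simp
  qed auto
  moreover have "(\<lambda>i. T (i, 1)) ` {1..n} \<subseteq> A"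
    using tableauxD(1)[OF T] b by (auto simp: PiE_iff)
  ultimately have "card {1..n} \<le> card A" using assms by (intro card_inj_on_le)
  then show False using assms by simp
qed

lemma tableau_sum_cong:
  assumes "\<And>b k. b \<in> \<theta> \<Longrightarrow> k \<in> A \<Longrightarrow> w k b = w' k b"
  shows "tableau_sum w \<theta> A = tableau_sum w' \<theta> A"
  unfolding tableau_sum_def
  by (intro sum.cong prod.cong refl assms) (auto simp: tableaux_def)

lemma tableau_sum_mult:
  assumes "finite \<theta>"
  shows "tableau_sum (\<lambda>k b. g b * w k b) \<theta> A = (\<Prod>b\<in>\<theta>. g b) * tableau_sum w \<theta> A"
  by (simp add: tableau_sum_def prod.distrib sum_distrib_left)

lemma tableau_sum_insert_largest:
  assumes "decreasing n f" "decreasing n g" "\<And>i. 1 \<le> i \<Longrightarrow> i \<le> n \<Longrightarrow> f i \<le> g i"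
    and "finite B" "\<And>b. b \<in> B \<Longrightarrow> b < k"
  shows "tableau_sum w (shape n g - shape n f) (insert k B) =
    (\<Sum>h\<in>shapes_between n f g.
      (if horizontal_strip n f h then \<Prod>i\<in>{1..n}. \<Prod>j\<in>{f i<..h i}. w k (i, j) else 0) *
      tableau_sum w (shape n g - shape n h) B)"
proof -
  have "tableau_sum w (shape n g - shape n f) ({k} \<union> B) =
      (\<Sum>h\<in>shapes_between n f g. tableau_sum w (shape n h - shape n f) {k} *
        tableau_sum w (shape n g - shape n h) B)"
    using assms by (intro tableau_sum_shape_Un) auto
  also have "\<dots> = (\<Sum>h\<in>shapes_between n f g.
      (if horizontal_strip n f h then \<Prod>i\<in>{1..n}. \<Prod>j\<in>{f i<..h i}. w k (i, j) else 0) *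
      tableau_sum w (shape n g - shape n h) B)"
    using assms by (intro sum.cong refl) (simp add: tableau_sum_singleton shapes_between_def)
  finally show ?thesis by simp
qed

text \<open>The entries in \<open>A\<close> fill at most \<open>n\<close> rows, so removing the
  boxes with entry \<open>k\<close> leaves a shape with empty last row. The strip condition then
  becomes interlacing of \<open>h\<close> with \<open>f\<close>, a condition on each row separately,
  and the index set is a product as in \<open>det1_sum_columns\<close>.\<close>

lemma tableau_sum_insert_least:
  assumes f: "decreasing (Suc n) f"
    and A: "finite A" "card A \<le> n" "\<And>a. a \<in> A \<Longrightarrow> k < a"
  shows "tableau_sum w (shape (Suc n) f) (insert k A) =
    (\<Sum>h\<in>PiE {1..n} (\<lambda>i. {f (Suc i)..f i}). tableau_sum w (shape n h) A *
      ((\<Prod>i\<in>{1..n}. \<Prod>j\<in>{h i<..f i}. w k (i, j)) * (\<Prod>j\<in>{1..f (Suc n)}. w k (Suc n, j))))"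
proof -
  let ?N = "Suc n" and ?z = "\<lambda>_. 0 :: nat"
  let ?S = "{h \<in> shapes_between ?N ?z f. h ?N = 0 \<and> horizontal_strip ?N h f}"
  let ?w = "\<lambda>h. tableau_sum w (shape ?N h) A *
    (if horizontal_strip ?N h f then \<Prod>i\<in>{1..?N}. \<Prod>j\<in>{h i<..f i}. w k (i, j) else 0)"
  have z: "shape ?N ?z = {}" by (auto simp: shape_def)
  have "tableau_sum w (shape ?N f - shape ?N ?z) (A \<union> {k}) =
      (\<Sum>h\<in>shapes_between ?N ?z f. tableau_sum w (shape ?N h - shape ?N ?z) A *
        tableau_sum w (shape ?N f - shape ?N h) {k})"
    using f A by (intro tableau_sum_shape_Un) (auto simp: decreasing_def)
  also have "\<dots> = (\<Sum>h\<in>shapes_between ?N ?z f. ?w h)"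
    using f by (intro sum.cong refl) (simp add: tableau_sum_singleton shapes_between_def z)
  \<comment> \<open>The dropped terms are 0: either the strip condition fails, or row n + 1 is
    nonempty and \<open>A\<close> has too few values.\<close>
  also have "\<dots> = (\<Sum>h\<in>?S. ?w h)"
  proof (rule sum.mono_neutral_right)
    show "\<forall>h\<in>shapes_between ?N ?z f - ?S. ?w h = 0"
    proof
      fix h assume h: "h \<in> shapes_between ?N ?z f - ?S"
      show "?w h = 0"
      proof (cases "horizontal_strip ?N h f")
        case True
        then have "1 \<le> h ?N" "decreasing ?N h" using h by (auto simp: shapes_between_def)
        then have "tableaux (shape ?N h) A = {}" using A by (intro tableaux_few_values) auto
        then show ?thesis by (simp add: tableau_sum_def)
      qed simp
    qed
  qed auto
  also have "\<dots> = (\<Sum>h\<in>PiE {1..n} (\<lambda>i. {f (Suc i)..f i}). tableau_sum w (shape n h) A *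
      ((\<Prod>i\<in>{1..n}. \<Prod>j\<in>{h i<..f i}. w k (i, j)) * (\<Prod>j\<in>{1..f (Suc n)}. w k (Suc n, j))))"
  proof (rule sum.reindex_bij_witness[where i = "\<lambda>h. h(?N := 0)" and j = "\<lambda>h. restrict h {1..n}"])
    fix h assume h: "h \<in> ?S"
    then have h': "h \<in> PiE {1..?N} (\<lambda>i. {0..f i})" "h ?N = 0" "horizontal_strip ?N h f"
      by (auto simp: shapes_between_def)
    show "(restrict h {1..n})(?N := 0) = h"
      using h'(2) PiE_arb[OF h'(1)] by (auto simp: fun_eq_iff)
    show "restrict h {1..n} \<in> PiE {1..n} (\<lambda>i. {f (Suc i)..f i})"
      using h' by (auto simp: horizontal_strip_def PiE_iff)
    have "shape n (restrict h {1..n}) = shape ?N h"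
      using h'(2) by (auto simp: shape_def le_Suc_eq)
    moreover have row: "{h ?N<..f ?N} = {1..f ?N}" using h'(2) by auto
    ultimately show "tableau_sum w (shape n (restrict h {1..n})) A *
        ((\<Prod>i\<in>{1..n}. \<Prod>j\<in>{restrict h {1..n} i<..f i}. w k (i, j)) *
          (\<Prod>j\<in>{1..f (Suc n)}. w k (Suc n, j))) = ?w h"
      using h'(3) row by simp
  next
    fix h assume h: "h \<in> PiE {1..n} (\<lambda>i. {f (Suc i)..f i})"
    then have b: "f (Suc i) \<le> h i" "h i \<le> f i" if "1 \<le> i" "i \<le> n" for i
      using that by (auto simp: PiE_iff)
    show "restrict (h(?N := 0)) {1..n} = h"
      using PiE_arb[OF h] by (auto simp: fun_eq_iff)
    \<comment> \<open>Interlacing already forces \<open>h\<close> to decrease.\<close>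
    have "h (Suc i) \<le> h i" if "1 \<le> i" "i < n" for i
      using b(1)[of i] b(2)[of "Suc i"] that by simp
    then have "decreasing ?N (h(?N := 0))" by (intro decreasingI) auto
    moreover have "h(?N := 0) \<in> PiE {1..?N} (\<lambda>i. {0..f i})"
      using h b(2) by (auto simp: PiE_iff extensional_def)
    ultimately show "h(?N := 0) \<in> ?S"
      using b(1) by (auto simp: shapes_between_def horizontal_strip_def)
  qed
  finally show ?thesis by (simp add: z)
qed

section \<open>Branching of the dual Schur determinant\<close>

lemma vandermonde_Suc:
  fixes x :: "nat \<Rightarrow> 'a :: comm_ring_1"
  shows "vandermonde (Suc n) x = (\<Prod>i\<in>{1..n}. x 1 - x (Suc i)) * vandermonde n (\<lambda>i. x (Suc i))"
proof -
  have shift: "(\<Prod>j\<in>{Suc i<..Suc n}. g j) = (\<Prod>j\<in>{i<..n}. g (Suc j))" for i and g :: "nat \<Rightarrow> 'a"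
    by (rule prod.reindex_bij_witness[of _ Suc "\<lambda>j. j - 1"]) auto
  have "vandermonde (Suc n) x =
      (\<Prod>j\<in>{1<..Suc n}. x 1 - x j) * (\<Prod>i\<in>{Suc 1..Suc n}. \<Prod>j\<in>{i<..Suc n}. x i - x j)"
    unfolding vandermonde_def by (rule prod.atLeast_Suc_atMost) simp
  also have "(\<Prod>j\<in>{1<..Suc n}. x 1 - x j) = (\<Prod>i\<in>{1..n}. x 1 - x (Suc i))"
    using shift[where i = 0] by (simp add: atLeastSucAtMost_greaterThanAtMost)
  also have "(\<Prod>i\<in>{Suc 1..Suc n}. \<Prod>j\<in>{i<..Suc n}. x i - x j) = vandermonde n (\<lambda>i. x (Suc i))"
    unfolding vandermonde_def prod.shift_bounds_cl_Suc_ivl shift by simp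
  finally show ?thesis .
qed

text \<open>The algebra rests only on an inverse \<open>v k i\<close> of 1 - c_k x_i and is done
  over any commutative ring; for power series \<open>v\<close> becomes the geometric series.\<close>

locale geometric_factors =
  fixes c :: "int \<Rightarrow> 'a :: comm_ring_1" and x :: "nat \<Rightarrow> 'a" and v :: "int \<Rightarrow> nat \<Rightarrow> 'a"
  assumes inverse: "(1 - c k * x i) * v k i = 1"
begin

definition u :: "int \<Rightarrow> nat \<Rightarrow> 'a" where
  "u k i = 1 - c k * x i"

lemma u_v [simp]: "u k i * v k i = 1"
  using inverse by (simp add: u_def)

lemma v_u [simp]: "v k i * u k i = 1"
  using inverse by (simp add: u_def mult.commute)

text \<open>
  Rows are measured by \<open>r = \<lambda>\<^sub>j + n - j\<close>, so that \<open>int n - r = j - \<lambda>\<^sub>j\<close>; then \<open>strip n s r\<close> is the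
  weight, in the variable \<open>x i\<close>, of the boxes added to a row when its measure grows from \<open>s\<close> to
  \<open>r\<close>. With \<open>v\<close> inverse to \<open>u\<close>, \<open>entry\<close> covers both cases of \<open>dual_entry\<close> at once, and
  \<open>weight p\<close> is the box weight for the variables with index greater than \<open>p\<close>.
\<close>

definition strip :: "nat \<Rightarrow> nat \<Rightarrow> nat \<Rightarrow> nat \<Rightarrow> 'a" where
  "strip n s r i = (\<Prod>t\<in>{s..<r}. x i * v (int n - 1 - int t) i)"

definition entry :: "nat \<Rightarrow> nat \<Rightarrow> nat \<Rightarrow> 'a" where
  "entry n r i = x i ^ r * (\<Prod>k\<in>{1..<n}. u (int k) i) * (\<Prod>t<r. v (int n - 1 - int t) i)"

definition weight :: "nat \<Rightarrow> nat \<Rightarrow> nat \<times> nat \<Rightarrow> 'a" where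
  "weight p k b = x k * (\<Prod>l\<in>{p<..<k}. u (1 - content b) l) * (\<Prod>l\<in>{p<..k}. v (- content b) l)"

lemma entry_Suc: "entry n (Suc r) i = entry n r i * (x i * v (int n - 1 - int r) i)"
  by (simp add: entry_def mult_ac)

text \<open>The extra factor prolongs the product of the \<open>v\<close>; read from the other end,
  this product starts with \<open>v (int n)\<close>, which cancels the numerator factor that n + 1
  rows have in addition.\<close>

lemma entry_decrease:
  assumes "1 \<le> n"
  shows "entry (Suc n) t i * v (int n - int t) i = entry n t i"
proof -
  have "(\<Prod>\<tau><t. v (int n - int \<tau>) i) * v (int n - int t) i = (\<Prod>\<tau><Suc t. v (int n - int \<tau>) i)"
    by simp
  also have "\<dots> = v (int n) i * (\<Prod>\<tau><t. v (int n - 1 - int \<tau>) i)"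
    by (subst prod.lessThan_Suc_shift) (simp add: algebra_simps)
  finally have *: "(\<Prod>\<tau><t. v (int n - int \<tau>) i) * v (int n - int t) i =
      v (int n) i * (\<Prod>\<tau><t. v (int n - 1 - int \<tau>) i)" .
  have "entry (Suc n) t i * v (int n - int t) i = x i ^ t * (\<Prod>k\<in>{1..<Suc n}. u (int k) i) *
      ((\<Prod>\<tau><t. v (int n - int \<tau>) i) * v (int n - int t) i)"
    by (simp add: entry_def mult_ac)
  also have "(\<Prod>k\<in>{1..<Suc n}. u (int k) i) = (\<Prod>k\<in>{1..<n}. u (int k) i) * u (int n) i"
    using assms by simp
  also have "x i ^ t * ((\<Prod>k\<in>{1..<n}. u (int k) i) * u (int n) i) *
      ((\<Prod>\<tau><t. v (int n - int \<tau>) i) * v (int n - int t) i) =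
      entry n t i * (u (int n) i * v (int n) i)"
    unfolding * entry_def by (simp only: mult_ac)
  finally show ?thesis by simp
qed

text \<open>A given row length has a measure one larger with n + 1 rows than with n rows, hence
  \<open>Suc t\<close>. The separate \<open>v\<close> is what \<open>entry_eliminate\<close> leaves
  in the eliminated variable.\<close>

definition interlacing_coeff :: "nat \<Rightarrow> nat \<Rightarrow> nat \<Rightarrow> nat \<Rightarrow> 'a" where
  "interlacing_coeff n r t i = v (int n - int t) i * strip (Suc n) (Suc t) r i"

text \<open>The elimination step for columns: the left side vanishes at i = p, which clears that
  row; in the other rows x_i - x_p splits off and entries for \<open>n\<close> rows remain.\<close>

lemma entry_eliminate:
  assumes n: "1 \<le> n" and "s \<le> r"
  shows "entry (Suc n) r i - strip (Suc n) s r p * entry (Suc n) s i =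
    (x i - x p) * (\<Sum>t\<in>{s..<r}. interlacing_coeff n r t p * entry n t i)"
  using \<open>s \<le> r\<close>
proof (induction r rule: dec_induct)
  case base
  then show ?case by (simp add: strip_def)
next
  case (step r)
  let ?e = "entry (Suc n)" and ?k = "int n - int r"
  have strip_Suc: "strip (Suc n) t (Suc r) p = strip (Suc n) t r p * (x p * v ?k p)" if "t \<le> r" for t
    using that by (simp add: strip_def)
  \<comment> \<open>The difference of two values of x / (1 - c x) is a multiple of x_i - x_p; its
    factor \<open>v ?k i\<close> turns \<open>entry (Suc n)\<close> into
    \<open>entry n\<close>.\<close>
  have v: "x i * v ?k i - x p * v ?k p = (x i - x p) * v ?k i * v ?k p"
  proof -
    have "x i * v ?k i - x p * v ?k p =
        x i * v ?k i * (u ?k p * v ?k p) - x p * v ?k p * (u ?k i * v ?k i)" by simp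
    also have "\<dots> = (x i - x p) * v ?k i * v ?k p" by (simp add: u_def algebra_simps)
    finally show ?thesis .
  qed
  have "?e (Suc r) i - strip (Suc n) s (Suc r) p * ?e s i =
      ?e r i * (x i * v ?k i - x p * v ?k p) +
      x p * v ?k p * (?e r i - strip (Suc n) s r p * ?e s i)"
    using step.hyps by (simp add: entry_Suc strip_Suc algebra_simps)
  also have "?e r i * (x i * v ?k i - x p * v ?k p) = (x i - x p) * (v ?k p * entry n r i)"
    unfolding v entry_decrease[OF n, of r i, symmetric] by (simp only: mult_ac)
  also have "x p * v ?k p * (?e r i - strip (Suc n) s r p * ?e s i) =
      (x i - x p) * (\<Sum>t\<in>{s..<r}. interlacing_coeff n (Suc r) t p * entry n t i)"
    unfolding step.IH
    by (simp add: interlacing_coeff_def strip_Suc sum_distrib_left mult_ac)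
  also have "v ?k p = interlacing_coeff n (Suc r) r p"
    by (simp add: interlacing_coeff_def strip_def)
  finally show ?case using step.hyps by (simp add: algebra_simps)
qed

text \<open>Contents grow by one along a row, so the \<open>u\<close> of a box cancels the
  \<open>v\<close> of its left neighbour and only the two ends remain.\<close>

lemma telescope_row:
  "(\<Prod>j\<in>{m<..m'}. u (1 - content (i, j)) l * v (- content (i, j)) l) * u (int i - int m') l =
    u (int i - int m) l" if "m \<le> m'"
  using that
proof (induction m' rule: dec_induct)
  case (step k)
  let ?P = "\<lambda>k. \<Prod>j\<in>{m<..k}. u (1 - content (i, j)) l * v (- content (i, j)) l"
  let ?u = "u (int i - int k) l" and ?u' = "u (int i - int (Suc k)) l" and ?v' = "v (int i - int (Suc k)) l"
  have "{m<..Suc k} = insert (Suc k) {m<..k}" using step.hyps by auto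
  then have "?P (Suc k) = ?u * ?v' * ?P k" by (simp add: content_def algebra_simps)
  then have "?P (Suc k) * ?u' = ?P k * ?u * (?v' * ?u')" by (simp only: mult_ac)
  then show ?case using step.IH by simp
qed simp

lemma telescope_row':
  "(\<Prod>j\<in>{1..m}. u (1 - content (i, j)) l * v (- content (i, j)) l) = u (int i) l * v (int i - int m) l"
proof -
  let ?P = "\<Prod>j\<in>{1..m}. u (1 - content (i, j)) l * v (- content (i, j)) l"
  have "?P = ?P * (u (int i - int m) l * v (int i - int m) l)" by simp
  also have "\<dots> = (?P * u (int i - int m) l) * v (int i - int m) l" by (simp only: mult.assoc)
  also have "?P * u (int i - int m) l = u (int i) l"
    using telescope_row[of 0 m i l] by (simp add: atLeastSucAtMost_greaterThanAtMost)
  finally show ?thesis .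
qed

lemma weight_first: "weight p (Suc p) (i, j) = x (Suc p) * v (int i - int j) (Suc p)"
proof -
  have "{p<..<Suc p} = {}" "{p<..Suc p} = {Suc p}" by auto
  then show ?thesis by (simp add: weight_def content_def)
qed

lemma weight_Suc:
  assumes "Suc p < k"
  shows "weight p k b = u (1 - content b) (Suc p) * v (- content b) (Suc p) * weight (Suc p) k b"
proof -
  have "{p<..<k} = insert (Suc p) {Suc p<..<k}" "{p<..k} = insert (Suc p) {Suc p<..k}"
    using assms by auto
  then show ?thesis by (simp add: weight_def mult_ac)
qed

text \<open>All entries exceed p + 1, so the dependence on that variable is the same for every
  tableau; it comes out of the sum and telescopes along the rows.\<close>

lemma tableau_sum_weight_Suc:
  "tableau_sum (weight p) (shape n h) {Suc p<..m} =
    (\<Prod>i\<in>{1..n}. u (int i) (Suc p) * v (int i - int (h i)) (Suc p)) *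
    tableau_sum (weight (Suc p)) (shape n h) {Suc p<..m}"
proof -
  have "tableau_sum (weight p) (shape n h) {Suc p<..m} =
      tableau_sum (\<lambda>k b. u (1 - content b) (Suc p) * v (- content b) (Suc p) * weight (Suc p) k b)
        (shape n h) {Suc p<..m}"
    by (rule tableau_sum_cong) (simp add: weight_Suc)
  also have "\<dots> = (\<Prod>b\<in>shape n h. u (1 - content b) (Suc p) * v (- content b) (Suc p)) *
      tableau_sum (weight (Suc p)) (shape n h) {Suc p<..m}"
    by (rule tableau_sum_mult) simp
  also have "(\<Prod>b\<in>shape n h. u (1 - content b) (Suc p) * v (- content b) (Suc p)) =
      (\<Prod>i\<in>{1..n}. \<Prod>j\<in>{1..h i}. u (1 - content (i, j)) (Suc p) * v (- content (i, j)) (Suc p))"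
    unfolding shape_def by (subst prod.Sigma) (auto simp: case_prod_unfold)
  finally show ?thesis unfolding telescope_row' .
qed

lemma det_entry_branching:
  assumes f: "decreasing (Suc n) f"
  shows "det1 (Suc n) (\<lambda>i j. entry (Suc n) (f j + Suc n - j) (p + i)) =
    (\<Prod>i\<in>{1..n}. x (Suc p) - x (Suc p + i)) * entry (Suc n) (f (Suc n)) (Suc p) *
    (\<Sum>h\<in>PiE {1..n} (\<lambda>j. {f (Suc j)..f j}).
      (\<Prod>j\<in>{1..n}. interlacing_coeff n (f j + Suc n - j) (h j + n - j) (Suc p)) *
      det1 n (\<lambda>i j. entry n (h j + n - j) (Suc p + i)))"
proof -
  let ?N = "Suc n" and ?q = "Suc p"
  let ?r = "\<lambda>j. f j + ?N - j"
  let ?c = "\<lambda>j. strip ?N (?r (Suc j)) (?r j) ?q"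
  let ?M = "\<lambda>i j. entry ?N (?r j) (p + i) - (if j = ?N then 0 else ?c j * entry ?N (?r (Suc j)) (p + i))"
  let ?b = "\<lambda>j. interlacing_coeff n (?r j)"
  have M: "?M i j = (x (p + i) - x ?q) *
      (\<Sum>h\<in>{f (Suc j)..f j}. ?b j (h + n - j) ?q * entry n (h + n - j) (p + i))"
    if j: "1 \<le> j" "j \<le> n" for i j
  proof -
    have "f (Suc j) \<le> f j" using f j by (auto simp: decreasing_def)
    then have r: "?r (Suc j) \<le> ?r j" using j by linarith
    have "?M i j = (x (p + i) - x ?q) *
        (\<Sum>t\<in>{?r (Suc j)..<?r j}. ?b j t ?q * entry n t (p + i))"
      using entry_eliminate[OF _ r, of n "p + i" ?q] j by simp
    \<comment> \<open>\<open>?r\<close> is taken for n + 1 rows but \<open>t\<close> for n rows, so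
      the half-open interval of measures becomes the closed interval of interlacing lengths.\<close>
    also have "(\<Sum>t\<in>{?r (Suc j)..<?r j}. ?b j t ?q * entry n t (p + i)) =
        (\<Sum>h\<in>{f (Suc j)..f j}. ?b j (h + n - j) ?q * entry n (h + n - j) (p + i))"
      by (rule sum.reindex_bij_witness[of _ "\<lambda>h. h + n - j" "\<lambda>t. t + j - n"]) (use j in auto)
    finally show ?thesis .
  qed
  have "det1 ?N (\<lambda>i j. entry ?N (?r j) (p + i)) = det1 ?N ?M"
    by (rule det1_add_column_right[symmetric])
  also have "\<dots> = (- 1) ^ n * ?M 1 ?N * det1 n (\<lambda>i j. ?M (Suc i) j)"
    by (rule det1_expand_row) (subst M; simp)
  also have "?M 1 ?N = entry ?N (f ?N) ?q" by simp
  also have "det1 n (\<lambda>i j. ?M (Suc i) j) = det1 n (\<lambda>i j. (x (?q + i) - x ?q) *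
      (\<Sum>h\<in>{f (Suc j)..f j}. ?b j (h + n - j) ?q * entry n (h + n - j) (?q + i)))"
    by (rule det1_cong) (subst M; simp)
  also have "\<dots> = (\<Prod>i\<in>{1..n}. x (?q + i) - x ?q) *
      (\<Sum>h\<in>PiE {1..n} (\<lambda>j. {f (Suc j)..f j}).
        (\<Prod>j\<in>{1..n}. ?b j (h j + n - j) ?q) * det1 n (\<lambda>i j. entry n (h j + n - j) (?q + i)))"
    by (subst det1_scale_rows, subst det1_sum_columns) simp_all
  finally have det: "det1 ?N (\<lambda>i j. entry ?N (?r j) (p + i)) = (- 1) ^ n * entry ?N (f ?N) ?q *
      ((\<Prod>i\<in>{1..n}. x (?q + i) - x ?q) * (\<Sum>h\<in>PiE {1..n} (\<lambda>j. {f (Suc j)..f j}).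
        (\<Prod>j\<in>{1..n}. ?b j (h j + n - j) ?q) * det1 n (\<lambda>i j. entry n (h j + n - j) (?q + i))))"
    (is "_ = _ * ?e * (?Y * ?S)") .
  \<comment> \<open>Reversing the n differences gives a sign that cancels the one of the row
    expansion.\<close>
  have "?Y = (\<Prod>i\<in>{1..n}. (- 1) * (x ?q - x (?q + i)))" by simp
  then have Y: "?Y = (- 1) ^ n * (\<Prod>i\<in>{1..n}. x ?q - x (?q + i))"
    by (simp only: prod.distrib prod_constant card_atLeastAtMost) simp
  have "(- 1) ^ n * ?e * (?Y * ?S) =
      ((- 1) ^ n * (- 1) ^ n) * ((\<Prod>i\<in>{1..n}. x ?q - x (?q + i)) * ?e * ?S)"
    unfolding Y by (simp only: mult_ac)
  also have "(- 1 :: 'a) ^ n * (- 1) ^ n = 1" by (simp flip: power_mult_distrib)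
  finally show ?thesis unfolding det by simp
qed

text \<open>With \<open>entry_eq\<close>, this rewrites the branching coefficients in terms of
  boxes, as they occur in tableau weights.\<close>

lemma interlacing_coeff_eq:
  assumes "1 \<le> j" "j \<le> n"
  shows "interlacing_coeff n (m + Suc n - j) (h + n - j) i =
    v (int j - int h) i * (\<Prod>b\<in>{h<..m}. x i * v (int j - int b) i)"
proof -
  have "strip (Suc n) (Suc (h + n - j)) (m + Suc n - j) i = (\<Prod>b\<in>{h<..m}. x i * v (int j - int b) i)"
    unfolding strip_def
    by (rule prod.reindex_bij_witness[of _ "\<lambda>b. b + n - j" "\<lambda>t. t + j - n"])
      (use assms in \<open>auto simp: of_nat_diff algebra_simps\<close>)
  moreover have "int n - int (h + n - j) = int j - int h" using assms by (simp add: of_nat_diff)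
  ultimately show ?thesis by (simp add: interlacing_coeff_def)
qed

lemma entry_eq:
  "entry (Suc n) m i = (\<Prod>k\<in>{1..n}. u (int k) i) * (\<Prod>j\<in>{1..m}. x i * v (int (Suc n) - int j) i)"
proof -
  have "(\<Prod>t<m. v (int (Suc n) - 1 - int t) i) = (\<Prod>j\<in>{1..m}. v (int (Suc n) - int j) i)"
    by (rule prod.reindex_bij_witness[of _ "\<lambda>j. j - 1" Suc]) auto
  then show ?thesis
    by (simp add: entry_def prod.distrib atLeastLessThanSuc_atLeastAtMost mult_ac)
qed

text \<open>Both sides obey the same branching rule: tableaux lose the entry p + 1, the determinant
  its first row. Each step removes one variable and one row, so the induction is on \<open>n\<close>
  with \<open>p\<close> arbitrary.\<close>

theorem vandermonde_tableau_sum: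
  assumes "decreasing n f"
  shows "vandermonde n (\<lambda>i. x (p + i)) * tableau_sum (weight p) (shape n f) {p<..p + n} =
    det1 n (\<lambda>i j. entry n (f j + n - j) (p + i))"
  using assms
proof (induction n arbitrary: p f)
  case 0
  show ?case by (simp add: shape_def tableau_sum_empty vandermonde_def det1_def)
next
  case (Suc n)
  let ?N = "Suc n" and ?q = "Suc p"
  let ?H = "PiE {1..n} (\<lambda>j. {f (Suc j)..f j})"
  let ?X = "\<Prod>i\<in>{1..n}. x ?q - x (?q + i)"
  let ?V = "vandermonde n (\<lambda>i. x (?q + i))"
  let ?w = "\<lambda>h. (\<Prod>i\<in>{1..n}. \<Prod>j\<in>{h i<..f i}. x ?q * v (int i - int j) ?q) *
      (\<Prod>j\<in>{1..f ?N}. x ?q * v (int ?N - int j) ?q)"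
  have IH: "?V * tableau_sum (weight ?q) (shape n h) {?q<..p + ?N} =
      det1 n (\<lambda>i j. entry n (h j + n - j) (?q + i))" if h: "h \<in> ?H" for h
  proof -
    have "decreasing n h"
    proof (rule decreasingI)
      fix i assume "1 \<le> i" "i < n"
      then have "h (Suc i) \<le> f (Suc i)" "f (Suc i) \<le> h i" using h by (auto simp: PiE_iff)
      then show "h (Suc i) \<le> h i" by simp
    qed
    then show ?thesis using Suc.IH[of h ?q] by simp
  qed
  have "tableau_sum (weight p) (shape ?N f) (insert ?q {?q<..p + ?N}) =
    (\<Sum>h\<in>?H. tableau_sum (weight p) (shape n h) {?q<..p + ?N} *
      ((\<Prod>i\<in>{1..n}. \<Prod>j\<in>{h i<..f i}. weight p ?q (i, j)) * (\<Prod>j\<in>{1..f ?N}. weight p ?q (?N, j))))"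
    by (rule tableau_sum_insert_least) (use Suc.prems in auto)
  moreover have "insert ?q {?q<..p + ?N} = {p<..p + ?N}" by auto
  ultimately have sum: "tableau_sum (weight p) (shape ?N f) {p<..p + ?N} =
    (\<Sum>h\<in>?H. (\<Prod>i\<in>{1..n}. u (int i) ?q * v (int i - int (h i)) ?q) *
      tableau_sum (weight ?q) (shape n h) {?q<..p + ?N} * ?w h)"
    by (simp only: weight_first tableau_sum_weight_Suc)
  have "vandermonde ?N (\<lambda>i. x (p + i)) = ?X * ?V"
    by (simp add: vandermonde_Suc)
  then have "vandermonde ?N (\<lambda>i. x (p + i)) * tableau_sum (weight p) (shape ?N f) {p<..p + ?N} =
    ?X * (\<Sum>h\<in>?H. ((\<Prod>i\<in>{1..n}. u (int i) ?q * v (int i - int (h i)) ?q) * ?w h) *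
      (?V * tableau_sum (weight ?q) (shape n h) {?q<..p + ?N}))"
    unfolding sum by (simp only: sum_distrib_left mult_ac)
  also have "\<dots> = ?X * (\<Sum>h\<in>?H. ((\<Prod>i\<in>{1..n}. u (int i) ?q * v (int i - int (h i)) ?q) * ?w h) *
      det1 n (\<lambda>i j. entry n (h j + n - j) (?q + i)))"
    by (simp only: IH cong: sum.cong)
  also have "\<dots> = ?X * (\<Sum>h\<in>?H. (entry ?N (f ?N) ?q *
      (\<Prod>j\<in>{1..n}. interlacing_coeff n (f j + ?N - j) (h j + n - j) ?q)) *
      det1 n (\<lambda>i j. entry n (h j + n - j) (?q + i)))"
  proof -
    \<comment> \<open>The factors \<open>v\<close> and the strips in rows 1 to n come from the
      interlacing coefficients, the numerators \<open>u\<close> and the last row from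
      \<open>entry\<close>.\<close>
    have "(\<Prod>j\<in>{1..n}. interlacing_coeff n (f j + ?N - j) (h j + n - j) ?q) =
        (\<Prod>j\<in>{1..n}. v (int j - int (h j)) ?q * (\<Prod>b\<in>{h j<..f j}. x ?q * v (int j - int b) ?q))" for h
      by (rule prod.cong[OF refl interlacing_coeff_eq]) auto
    then have "entry ?N (f ?N) ?q *
        (\<Prod>j\<in>{1..n}. interlacing_coeff n (f j + ?N - j) (h j + n - j) ?q) =
        (\<Prod>i\<in>{1..n}. u (int i) ?q * v (int i - int (h i)) ?q) * ?w h" for h
      unfolding entry_eq prod.distrib[of "\<lambda>i. u (int i) ?q"] by (simp only: prod.distrib mult_ac)
    then show ?thesis by (simp only:)
  qed
  also have "\<dots> = det1 ?N (\<lambda>i j. entry ?N (f j + ?N - j) (p + i))"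
    unfolding det_entry_branching[OF Suc.prems] by (simp add: sum_distrib_left mult_ac)
  finally show ?case .
qed

end

section \<open>Truncation and summability of power series\<close>

lemma mconst_0 [simp]: "mconst 0 = 0"
  by (rule mfps_eqI) (simp add: mconst.rep_eq zero_mfps.rep_eq)

lemma mconst_1 [simp]: "mconst 1 = (1 :: 'a :: comm_ring_1 mfps)"
  by (rule mfps_eqI) (simp add: mconst.rep_eq one_mfps.rep_eq)

lemma mconst_add: "mconst (a + b) = mconst a + mconst (b :: 'a :: comm_ring_1)"
  by (rule mfps_eqI) (simp add: mconst.rep_eq plus_mfps.rep_eq)

lemma mconst_diff: "mconst (a - b) = mconst a - mconst (b :: 'a :: comm_ring_1)"
  by (rule mfps_eqI) (simp add: mconst.rep_eq minus_mfps.rep_eq)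

lemma mconst_mult: "mconst (a * b) = mconst a * mconst (b :: 'a :: comm_ring_1)"
  by (rule mfps_eqI) (simp add: mcoeff_const_mult mconst.rep_eq)

lemma truncate_vars_0 [simp]: "truncate_vars n 0 = 0"
  by (rule mfps_eqI) (simp add: truncate_vars.rep_eq zero_mfps.rep_eq)

lemma truncate_vars_add:
  "truncate_vars n (f + g) = truncate_vars n f + truncate_vars n (g :: 'a :: comm_ring_1 mfps)"
  by (rule mfps_eqI) (simp add: truncate_vars.rep_eq plus_mfps.rep_eq)

lemma truncate_vars_diff:
  "truncate_vars n (f - g) = truncate_vars n f - truncate_vars n (g :: 'a :: comm_ring_1 mfps)"
  by (rule mfps_eqI) (simp add: truncate_vars.rep_eq minus_mfps.rep_eq)

lemma truncate_vars_mconst [simp]: "truncate_vars n (mconst c) = mconst c"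
  by (rule mfps_eqI) (simp add: truncate_vars.rep_eq mconst.rep_eq)

lemma truncate_vars_1 [simp]: "truncate_vars n 1 = (1 :: 'a :: comm_ring_1 mfps)"
  by (metis mconst_1 truncate_vars_mconst)

lemma truncate_vars_mvar:
  "truncate_vars n (mvar k) = (if k \<le> n then mvar k else 0 :: 'a :: comm_ring_1 mfps)"
  by (rule mfps_eqI) (auto simp: truncate_vars.rep_eq mvar.rep_eq zero_mfps.rep_eq)

lemma truncate_vars_mgeom:
  "truncate_vars n (mgeom c k) = (if k \<le> n then mgeom c k else 1)"
proof (rule mfps_eqI)
  fix m :: "nat \<Rightarrow>\<^sub>0 nat"
  have "m = 0" if "Poly_Mapping.keys m \<subseteq> {..n}" "Poly_Mapping.keys m \<subseteq> {k}" "\<not> k \<le> n"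
  proof -
    have "i \<notin> Poly_Mapping.keys m" for i using that by auto
    then have "Poly_Mapping.keys m = {}" by blast
    then show ?thesis by simp
  qed
  then show "mcoeff (truncate_vars n (mgeom c k)) m = mcoeff (if k \<le> n then mgeom c k else 1) m"
    by (auto simp: truncate_vars.rep_eq mgeom.rep_eq one_mfps.rep_eq)
qed

text \<open>A product of monomials involves only variables up to \<open>n\<close> exactly when both
  factors do.\<close>

lemma truncate_vars_mult:
  "truncate_vars n (f * g) = truncate_vars n f * truncate_vars n (g :: 'a :: comm_ring_1 mfps)"
proof (rule mfps_eqI)
  fix m :: "nat \<Rightarrow>\<^sub>0 nat"
  have keys: "Poly_Mapping.keys m = Poly_Mapping.keys p \<union> Poly_Mapping.keys q"
    if "(p, q) \<in> splits m" for p q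
    using that keys_add_nat[of p q] by (simp add: splits_def)
  have "(\<Sum>(p, q)\<in>splits m. mcoeff (truncate_vars n f) p * mcoeff (truncate_vars n g) q) =
      (\<Sum>(p, q)\<in>splits m. if Poly_Mapping.keys m \<subseteq> {..n} then mcoeff f p * mcoeff g q else 0)"
    by (rule sum.cong) (auto simp: truncate_vars.rep_eq dest!: keys)
  then show "mcoeff (truncate_vars n (f * g)) m = mcoeff (truncate_vars n f * truncate_vars n g) m"
    by (simp add: truncate_vars.rep_eq times_mfps.rep_eq)
qed

lemma truncate_vars_prod:
  "truncate_vars n (\<Prod>i\<in>A. f i) = (\<Prod>i\<in>A. truncate_vars n (f i :: 'a :: comm_ring_1 mfps))"
  by (induction A rule: infinite_finite_induct) (simp_all add: truncate_vars_mult)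

lemma truncate_vars_sum:
  "truncate_vars n (\<Sum>i\<in>A. f i) = (\<Sum>i\<in>A. truncate_vars n (f i :: 'a :: comm_ring_1 mfps))"
  by (induction A rule: infinite_finite_induct) (simp_all add: truncate_vars_add)

lemma mcoeff_truncate_vars:
  "Poly_Mapping.keys m \<subseteq> {..n} \<Longrightarrow> mcoeff (truncate_vars n f) m = mcoeff f m"
  by (simp add: truncate_vars.rep_eq)

lemma open_mcoeff_eq: "open {h. mcoeff h m = c}"
  unfolding open_mfps_def by (auto intro!: exI[of _ "{m}"])

text \<open>For each monomial any finite set containing the contributing terms may serve, so a
  convenient one can be chosen.\<close>

lemma has_sum_mfpsI:
  fixes f :: "'b \<Rightarrow> 'a :: comm_ring_1 mfps"
  assumes "\<And>m. \<exists>X. finite X \<and> X \<subseteq> A \<and> {t \<in> A. mcoeff (f t) m \<noteq> 0} \<subseteq> X \<and>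
    mcoeff s m = (\<Sum>t\<in>X. mcoeff (f t) m)"
  shows "(f has_sum s) A"
  unfolding has_sum_def
proof (rule topological_tendstoI)
  have "\<exists>X. \<forall>m. finite (X m) \<and> X m \<subseteq> A \<and> {t \<in> A. mcoeff (f t) m \<noteq> 0} \<subseteq> X m \<and>
      mcoeff s m = (\<Sum>t\<in>X m. mcoeff (f t) m)"
    by (rule choice) (use assms in blast)
  then obtain X where X: "finite (X m)" "X m \<subseteq> A" "{t \<in> A. mcoeff (f t) m \<noteq> 0} \<subseteq> X m"
    "mcoeff s m = (\<Sum>t\<in>X m. mcoeff (f t) m)" for m
    by blast
  fix U assume "open U" "s \<in> U"
  then obtain M where M: "finite M" "\<forall>g. (\<forall>m\<in>M. mcoeff g m = mcoeff s m) \<longrightarrow> g \<in> U"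
    unfolding open_mfps_def by blast
  have "sum f Y \<in> U" if Y: "finite Y" "(\<Union>m\<in>M. X m) \<subseteq> Y" "Y \<subseteq> A" for Y
  proof -
    have "mcoeff (sum f Y) m = mcoeff s m" if m: "m \<in> M" for m
      unfolding mcoeff_sum X(4)
      by (rule sum.mono_neutral_right) (use Y m X(3)[of m] in auto)
    then show ?thesis using M(2) by blast
  qed
  then show "\<forall>\<^sub>F Y in finite_subsets_at_top A. sum f Y \<in> U"
    unfolding eventually_finite_subsets_at_top using X M(1)
    by (intro exI[of _ "\<Union>m\<in>M. X m"]) auto
qed

lemma has_sum_mfpsD:
  fixes f :: "'b \<Rightarrow> 'a :: comm_ring_1 mfps"
  assumes "(f has_sum s) A"
  shows "finite {t \<in> A. mcoeff (f t) m \<noteq> 0}"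
    and "mcoeff s m = (\<Sum>t\<in>{t \<in> A. mcoeff (f t) m \<noteq> 0}. mcoeff (f t) m)"
proof -
  have "\<forall>\<^sub>F Y in finite_subsets_at_top A. sum f Y \<in> {h. mcoeff h m = mcoeff s m}"
    using assms unfolding has_sum_def by (rule topological_tendstoD) (auto simp: open_mcoeff_eq)
  then obtain X where X: "finite X" "X \<subseteq> A"
    and eq: "\<And>Y. finite Y \<Longrightarrow> X \<subseteq> Y \<Longrightarrow> Y \<subseteq> A \<Longrightarrow> (\<Sum>t\<in>Y. mcoeff (f t) m) = mcoeff s m"
    unfolding eventually_finite_subsets_at_top by (auto simp: mcoeff_sum)
  have sub: "{t \<in> A. mcoeff (f t) m \<noteq> 0} \<subseteq> X"
  proof
    fix t assume t: "t \<in> {t \<in> A. mcoeff (f t) m \<noteq> 0}"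
    \<comment> \<open>Adding a single term to \<open>X\<close> leaves the coefficient unchanged, so
      terms outside \<open>X\<close> do not contribute.\<close>
    show "t \<in> X"
      using eq[of X] eq[of "insert t X"] X t by (cases "t \<in> X") auto
  qed
  then show "finite {t \<in> A. mcoeff (f t) m \<noteq> 0}" using X(1) finite_subset by blast
  have "(\<Sum>t\<in>{t \<in> A. mcoeff (f t) m \<noteq> 0}. mcoeff (f t) m) = (\<Sum>t\<in>X. mcoeff (f t) m)"
    by (rule sum.mono_neutral_left) (use X sub in auto)
  then show "mcoeff s m = (\<Sum>t\<in>{t \<in> A. mcoeff (f t) m \<noteq> 0}. mcoeff (f t) m)"
    using eq[of X] X by simp
qed

section \<open>Tableau presentation of the dual Schur functions\<close>

lemma tableau_factor_eq:
  "tableau_factor k g h =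
    mvar k * (\<Prod>l\<in>{1..<k}. 1 - mconst g * mvar l) * (\<Prod>l\<in>{1..k}. mgeom h l)"
proof -
  have "inverse (\<Prod>l\<in>{1..k}. 1 - mconst h * mvar l) = (\<Prod>l\<in>{1..k}. mgeom h l)"
    by (rule mfps_inverse_eqI) (simp add: mgeom_eq flip: prod.distrib)
  then show ?thesis by (simp add: tableau_factor_def divide_mfps_def)
qed

text \<open>The factor is divisible by \<open>mvar k\<close> and involves no later variable, so
  truncation keeps it whole or kills it.\<close>

lemma truncate_vars_tableau_factor:
  "truncate_vars n (tableau_factor k g h) = (if k \<le> n then tableau_factor k g h else 0)"
proof (cases "k \<le> n")
  case True
  then show ?thesis
    by (auto simp: tableau_factor_eq truncate_vars_mult truncate_vars_prod truncate_vars_diff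
        truncate_vars_mvar truncate_vars_mgeom intro!: arg_cong2[where f = "(*)"] prod.cong)
qed (simp add: tableau_factor_eq truncate_vars_mult truncate_vars_mvar)

definition box_weight :: "(int \<Rightarrow> 'r :: comm_ring_1) \<Rightarrow> nat \<Rightarrow> nat \<times> nat \<Rightarrow> 'r mfps" where
  "box_weight a k b = tableau_factor k (a (- content b + 1)) (a (- content b))"

text \<open>Tableaux with an entry above \<open>n\<close> vanish under truncation, so the infinite
  sum becomes finite.\<close>

lemma truncate_vars_skew_dual_schur:
  assumes "finite \<theta>"
  shows "truncate_vars n (skew_dual_schur a \<theta>) = tableau_sum (box_weight a) \<theta> {1..n}"
proof -
  let ?w = "tableau_weight a \<theta>"
  have w: "?w T = (\<Prod>b\<in>\<theta>. box_weight a (T b) b)" for T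
    by (simp add: tableau_weight_def box_weight_def)
  have large: "truncate_vars n (?w T) = 0"
    if T: "T \<in> tableaux \<theta> {1..} - tableaux \<theta> {1..n}" for T
  proof -
    have "\<exists>b\<in>\<theta>. \<not> T b \<le> n" using T by (auto simp: tableaux_def PiE_iff)
    then obtain b where b: "b \<in> \<theta>" "\<not> T b \<le> n" by blast
    then have "truncate_vars n (box_weight a (T b) b) = 0"
      by (simp add: box_weight_def truncate_vars_tableau_factor)
    then show ?thesis
      using b(1) assms unfolding w truncate_vars_prod by (intro prod_zero) auto
  qed
  have sub: "tableaux \<theta> {1..n} \<subseteq> tableaux \<theta> {1..}"
    by (auto simp: tableaux_def)
  have sum: "(?w has_sum skew_dual_schur a \<theta>) (tableaux \<theta> {1..})"
    unfolding skew_dual_schur_def reverse_tableaux_eq[symmetric]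
    by (intro has_sum_infsum tableau_weight_summable assms)
  have "truncate_vars n (skew_dual_schur a \<theta>) = truncate_vars n (\<Sum>T\<in>tableaux \<theta> {1..n}. ?w T)"
  proof (rule mfps_eqI)
    fix m :: "nat \<Rightarrow>\<^sub>0 nat"
    show "mcoeff (truncate_vars n (skew_dual_schur a \<theta>)) m =
        mcoeff (truncate_vars n (\<Sum>T\<in>tableaux \<theta> {1..n}. ?w T)) m"
    proof (cases "Poly_Mapping.keys m \<subseteq> {..n}")
      case True
      have "mcoeff (?w T) m = 0" if "T \<in> tableaux \<theta> {1..} - tableaux \<theta> {1..n}" for T
        using large[OF that] True by (metis mcoeff_truncate_vars zero_mfps.rep_eq)
      then have "(\<Sum>T\<in>{T \<in> tableaux \<theta> {1..}. mcoeff (?w T) m \<noteq> 0}. mcoeff (?w T) m) =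
          (\<Sum>T\<in>tableaux \<theta> {1..n}. mcoeff (?w T) m)"
        by (intro sum.mono_neutral_left) (use sub in \<open>auto simp: finite_tableaux assms\<close>)
      then show ?thesis
        using True by (simp add: mcoeff_truncate_vars has_sum_mfpsD(2)[OF sum] mcoeff_sum)
    qed (simp add: truncate_vars.rep_eq)
  qed
  also have "\<dots> = (\<Sum>T\<in>tableaux \<theta> {1..n}. ?w T)"
    unfolding truncate_vars_sum
  proof (rule sum.cong)
    fix T assume "T \<in> tableaux \<theta> {1..n}"
    then have "truncate_vars n (box_weight a (T b) b) = box_weight a (T b) b" if "b \<in> \<theta>" for b
      using that by (auto simp: tableaux_def PiE_iff box_weight_def truncate_vars_tableau_factor)
    then show "truncate_vars n (?w T) = ?w T" unfolding w truncate_vars_prod by (rule prod.cong[OF refl])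
  qed simp
  finally show ?thesis by (simp add: tableau_sum_def w)
qed

interpretation mfps: geometric_factors "\<lambda>k. mconst (a k)" mvar "\<lambda>k i. mgeom (a k) i"
  for a :: "int \<Rightarrow> 'r :: comm_ring_1"
  by unfold_locales (rule mgeom_eq)

lemma box_weight_eq: "box_weight a = mfps.weight a 0"
proof (intro ext)
  fix k :: nat and b
  have "{0<..<k} = {1..<k}" "{0<..k} = {1..k}" by auto
  moreover have "1 - content b = - content b + 1" by simp
  ultimately show "box_weight a k b = mfps.weight a 0 k b"
    by (simp add: box_weight_def tableau_factor_eq mfps.weight_def mfps.u_def)
qed

section \<open>Partitions and the entries of the dual determinant\<close>

lemma part_antimono:
  assumes "is_partition lam" "1 \<le> i" "i \<le> j"
  shows "part lam j \<le> part lam i"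
proof (cases "i = j \<or> length lam < j")
  case False
  then have "lam ! (j - 1) \<le> lam ! (i - 1)"
    using assms sorted_wrt_nth_less[of "(\<ge>)" lam "i - 1" "j - 1"] by (auto simp: is_partition_def)
  then show ?thesis using False assms by (simp add: part_def)
qed (auto simp: part_def)

lemma decreasing_part: "is_partition lam \<Longrightarrow> decreasing n (part lam)"
  by (auto simp: decreasing_def part_antimono)

lemma part_pos: "is_partition lam \<Longrightarrow> 1 \<le> i \<Longrightarrow> i \<le> length lam \<Longrightarrow> 1 \<le> part lam i"
  by (auto simp: part_def is_partition_def in_set_conv_nth Suc_le_eq intro!: gr0I)

lemma diagram_eq_shape: "length lam \<le> n \<Longrightarrow> diagram lam = shape n (part lam)"
  by (auto simp: diagram_def shape_def part_def split: if_splits)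

text \<open>The rows that reach the diagonal form an initial segment, so counting the diagonal boxes
  locates the last one.\<close>

lemma le_diagonal_iff:
  assumes "is_partition lam" "1 \<le> j"
  shows "j \<le> diagonal lam \<longleftrightarrow> j \<le> part lam j"
proof -
  let ?D = "{i. (i, i) \<in> diagram lam}"
  have D: "?D = {i. 1 \<le> i \<and> i \<le> part lam i}" by (auto simp: diagram_def)
  have "?D \<subseteq> {..length lam}" unfolding D by (auto simp: part_def split: if_splits)
  then have fin: "finite ?D" by (rule finite_subset) simp
  show ?thesis
  proof
    assume j: "j \<le> part lam j"
    have "{1..j} \<subseteq> ?D"
    proof
      fix i assume i: "i \<in> {1..j}"
      then have "part lam j \<le> part lam i" using assms by (intro part_antimono) auto
      then show "i \<in> ?D" using i j by (simp add: D)
    qed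
    then have "card {1..j} \<le> card ?D" using fin by (rule card_mono[rotated])
    then show "j \<le> diagonal lam" by (simp add: diagonal_def)
  next
    assume j: "j \<le> diagonal lam"
    show "j \<le> part lam j"
    proof (rule ccontr)
      assume "\<not> j \<le> part lam j"
      moreover have "part lam i \<le> part lam j" if "j \<le> i" for i
        using assms that by (intro part_antimono) auto
      ultimately have "?D \<subseteq> {1..<j}" unfolding D by (force simp: not_le)
      then have "card ?D \<le> card {1..<j}" by (intro card_mono) auto
      then show False using j assms by (simp add: diagonal_def)
    qed
  qed
qed

text \<open>\<open>mfps.entry\<close> has numerators with indices 1 to n - 1 and inverses with
  indices from j - lam_j to n - 1. Cancelling the common indices leaves inverses up to index 0 if j
  \<le> lam_j, and numerators up to index j - lam_j - 1 otherwise.\<close>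

lemma dual_entry_eq:
  assumes lam: "is_partition lam" and j: "1 \<le> j" "j \<le> n"
  shows "dual_entry a n lam i j = mfps.entry a n (part lam j + n - j) i"
proof -
  let ?r = "part lam j + n - j"
  let ?u = "mfps.u a" and ?v = "\<lambda>k. mgeom (a k) i"
  have u: "1 - mconst (a k) * mvar i = ?u k i" for k by (simp add: mfps.u_def)
  have pu: "(\<Prod>k\<in>{1..<n}. ?u (int k) i) = (\<Prod>k\<in>{1..int n - 1}. ?u k i)"
    by (rule prod.reindex_bij_witness[of _ nat int]) auto
  have pv: "(\<Prod>t<?r. ?v (int n - 1 - int t)) = (\<Prod>k\<in>{int j - int (part lam j)..int n - 1}. ?v k)"
    by (rule prod.reindex_bij_witness[of _ "\<lambda>k. nat (int n - 1 - k)" "\<lambda>t. int n - 1 - int t"])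
      (use j in auto)
  have cancel: "(\<Prod>k\<in>A. ?u k i) * (\<Prod>k\<in>A. ?v k) = 1" for A
    by (simp flip: prod.distrib)
  show ?thesis
  proof (cases "j \<le> diagonal lam")
    case True
    then have "j \<le> part lam j" using le_diagonal_iff lam j by simp
    then have "{int j - int (part lam j)..int n - 1} = {int j - int (part lam j)..0} \<union> {1..int n - 1}"
      using j by auto
    then have "(\<Prod>k\<in>{int j - int (part lam j)..int n - 1}. ?v k) =
        (\<Prod>k\<in>{int j - int (part lam j)..0}. ?v k) * (\<Prod>k\<in>{1..int n - 1}. ?v k)"
      by (simp add: prod.union_disjoint)
    then have "mfps.entry a n ?r i = mvar i ^ ?r * (\<Prod>k\<in>{int j - int (part lam j)..0}. ?v k) *
        ((\<Prod>k\<in>{1..int n - 1}. ?u k i) * (\<Prod>k\<in>{1..int n - 1}. ?v k))"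
      unfolding mfps.entry_def pu pv by (simp only: mult_ac)
    moreover have "inverse (\<Prod>k\<in>{int j - int (part lam j)..0}. ?u k i) =
        (\<Prod>k\<in>{int j - int (part lam j)..0}. ?v k)"
      by (rule mfps_inverse_eqI) (rule cancel)
    ultimately show ?thesis
      using True by (simp add: dual_entry_def divide_mfps_def u cancel)
  next
    case False
    then have "\<not> j \<le> part lam j" using le_diagonal_iff lam j by simp
    then have "{1..int n - 1} = {1..int j - int (part lam j) - 1} \<union> {int j - int (part lam j)..int n - 1}"
      using j by auto
    then have "(\<Prod>k\<in>{1..int n - 1}. ?u k i) = (\<Prod>k\<in>{1..int j - int (part lam j) - 1}. ?u k i) *
        (\<Prod>k\<in>{int j - int (part lam j)..int n - 1}. ?u k i)"
      by (simp add: prod.union_disjoint)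
    then have "mfps.entry a n ?r i = mvar i ^ ?r * (\<Prod>k\<in>{1..int j - int (part lam j) - 1}. ?u k i) *
        ((\<Prod>k\<in>{int j - int (part lam j)..int n - 1}. ?u k i) *
          (\<Prod>k\<in>{int j - int (part lam j)..int n - 1}. ?v k))"
      unfolding mfps.entry_def pu pv by (simp only: mult_ac)
    then show ?thesis using False by (simp add: dual_entry_def u cancel)
  qed
qed

lemma vandermonde_mvar_nonzero: "vandermonde n mvar \<noteq> (0 :: 'r :: idom mfps)"
proof -
  have "mvar i - mvar j \<noteq> (0 :: 'r mfps)" if "i < j" for i j
  proof
    assume "mvar i - mvar j = (0 :: 'r mfps)"
    then have "mcoeff (mvar i - mvar j :: 'r mfps) (Poly_Mapping.single i 1) = 0"
      by (simp add: zero_mfps.rep_eq)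
    moreover have "Poly_Mapping.single i (1 :: nat) \<noteq> Poly_Mapping.single j 1"
    proof
      assume "Poly_Mapping.single i (1 :: nat) = Poly_Mapping.single j 1"
      then have "Poly_Mapping.lookup (Poly_Mapping.single i (1 :: nat)) i =
          Poly_Mapping.lookup (Poly_Mapping.single j 1) i" by simp
      then show False using that by (simp add: lookup_single)
    qed
    ultimately show False by (simp add: minus_mfps.rep_eq mvar.rep_eq)
  qed
  then show ?thesis by (auto simp: vandermonde_def)
qed

text \<open>\<open>dual_schur\<close> is fixed by its truncations, so it suffices that those of the
  tableau series give the quotients of determinants.\<close>

theorem dual_schur_eq_tableaux:
  assumes lam: "is_partition lam"
  shows "dual_schur a lam = skew_dual_schur a (diagram lam :: _ set)"
proof -
  let ?S = "skew_dual_schur a (diagram lam)"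
  have fin: "to_fract (truncate_vars n ?S) = dual_schur_fin a n lam" for n
  proof (cases "length lam \<le> n")
    case True
    let ?V = "vandermonde n mvar"
    have "det1 n (dual_entry a n lam) = det1 n (\<lambda>i j. mfps.entry a n (part lam j + n - j) (0 + i))"
      by (rule det1_cong) (simp add: dual_entry_eq lam)
    also have "\<dots> = ?V * tableau_sum (box_weight a) (shape n (part lam)) {0<..0 + n}"
      using mfps.vandermonde_tableau_sum[OF decreasing_part[OF lam], where a = a and p = 0]
      by (simp add: box_weight_eq)
    also have "{0<..0 + n} = {1..n}" by auto
    finally have "det1 n (dual_entry a n lam) = ?V * truncate_vars n ?S"
      using True by (simp add: truncate_vars_skew_dual_schur diagram_eq_shape)
    then show ?thesis
      using True by (simp add: dual_schur_fin_def vandermonde_mvar_nonzero)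
  next
    case False
    \<comment> \<open>With fewer variables than rows the first column cannot be filled, in agreement
      with the value 0.\<close>
    let ?l = "length lam"
    have "1 \<le> part lam ?l" using False by (intro part_pos[OF lam]) auto
    then have "tableaux (shape ?l (part lam)) {1..n} = {}"
      using False lam by (intro tableaux_few_values) (auto simp: decreasing_part)
    then have "truncate_vars n ?S = 0"
      by (simp add: truncate_vars_skew_dual_schur finite_diagram diagram_eq_shape[of lam ?l]
          tableau_sum_def)
    then show ?thesis using False by (simp add: dual_schur_fin_def)
  qed
  show ?thesis
    unfolding dual_schur_def
  proof (rule the_equality)
    fix f assume f: "\<forall>n. to_fract (truncate_vars n f) = dual_schur_fin a n lam"
    have "truncate_vars n f = truncate_vars n ?S" for n
      using f fin by (metis to_fract_eq_iff)
    then show "f = ?S" by (rule truncate_vars_inject)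
  qed (simp add: fin)
qed

section \<open>The Cauchy identity in finitely many variables\<close>

context geometric_factors
begin

text \<open>The function g_r of the introductory comment: \<open>z\<close> is its x,
  \<open>x l\<close> its y, and \<open>w\<close> stands for the inverse of 1 - z y.\<close>

definition completed :: "nat \<Rightarrow> 'a \<Rightarrow> 'a \<Rightarrow> nat \<Rightarrow> nat \<Rightarrow> 'a" where
  "completed n z w l r = double_power c n z r * u (int n - int r) l * w"

lemma completed_unfold:
  assumes w: "(1 - z * x l) * w = 1" and "s \<le> r"
  shows "completed n z w l s =
    (\<Sum>t\<in>{s..<r}. strip n s t l * double_power c n z t) + strip n s r l * completed n z w l r"
  using \<open>s \<le> r\<close>
proof (induction r rule: dec_induct)
  case base
  then show ?case by (simp add: strip_def)
next
  case (step r)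
  let ?k = "int n - 1 - int r" and ?P = "double_power c n z"
  have k: "int n - int (Suc r) = ?k" by simp
  have "x l * v ?k l * completed n z w l (Suc r) =
      x l * ?P r * (z - c (int n - int r)) * w * (u ?k l * v ?k l)"
    unfolding completed_def double_power_def k prod.lessThan_Suc by (simp only: mult_ac)
  then have "?P r + x l * v ?k l * completed n z w l (Suc r) =
      ?P r * ((1 - z * x l) * w) + x l * ?P r * (z - c (int n - int r)) * w"
    using w by simp
  \<comment> \<open>With y = \<open>x l\<close>: (1 - z y) + y (z - c_k) = 1 - c_k y for k = n -
    r.\<close>
  also have "\<dots> = completed n z w l r"
    by (simp add: completed_def u_def algebra_simps)
  finally have rec: "completed n z w l r = ?P r + x l * v ?k l * completed n z w l (Suc r)" ..
  have "strip n s (Suc r) l = strip n s r l * (x l * v ?k l)"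
    using step.hyps by (simp add: strip_def)
  then show ?case
    unfolding step.IH by (subst rec) (use step.hyps in \<open>simp add: algebra_simps\<close>)
qed

lemma strip_eq:
  assumes "1 \<le> i" "i \<le> n"
  shows "strip n (m + n - i) (h + n - i) l = (\<Prod>j\<in>{m<..h}. x l * v (int i - int j) l)"
  unfolding strip_def
  by (rule prod.reindex_bij_witness[of _ "\<lambda>b. b - 1 + n - i" "\<lambda>t. t + 1 + i - n"])
    (use assms in \<open>auto simp: of_nat_diff algebra_simps\<close>)

text \<open>The strip condition bounds row j + 1 by \<open>f j\<close>, not by \<open>h j\<close>;
  so the rows vary independently and the index set is a product, as in
  \<open>det1_sum_columns\<close>.\<close>

lemma horizontal_strips_eq:
  assumes f: "decreasing n f" and K: "\<And>i. 1 \<le> i \<Longrightarrow> i \<le> n \<Longrightarrow> f i \<le> K"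
  shows "{h \<in> shapes_between n f (\<lambda>_. K). horizontal_strip n f h} =
    PiE {1..n} (\<lambda>j. {f j..if j = 1 then K else f (j - 1)})"
proof (intro equalityI subsetI)
  fix h assume h: "h \<in> {h \<in> shapes_between n f (\<lambda>_. K). horizontal_strip n f h}"
  have "h j \<le> f (j - 1)" if "1 \<le> j" "j \<le> n" "j \<noteq> 1" for j
    using h that unfolding horizontal_strip_def
    by (auto dest!: spec[where x = "j - 1"])
  then show "h \<in> PiE {1..n} (\<lambda>j. {f j..if j = 1 then K else f (j - 1)})"
    using h by (auto simp: shapes_between_def PiE_iff)
next
  fix h assume h: "h \<in> PiE {1..n} (\<lambda>j. {f j..if j = 1 then K else f (j - 1)})"
  have lower: "f j \<le> h j" if "1 \<le> j" "j \<le> n" for j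
    using h that by (auto simp: PiE_iff)
  have strip: "h (Suc j) \<le> f j" if "1 \<le> j" "j < n" for j
    using PiE_mem[OF h, of "Suc j"] that by simp
  have upper: "h j \<le> K" if "1 \<le> j" "j \<le> n" for j
  proof (cases "j = 1")
    case False
    then have "f (j - 1) \<le> K" using that by (intro K) auto
    then show ?thesis using PiE_mem[OF h, of j] that False by simp
  qed (use PiE_mem[OF h, of j] that in simp)
  have "decreasing n h"
    using lower strip by (intro decreasingI) (meson less_imp_le order_trans)
  then show "h \<in> {h \<in> shapes_between n f (\<lambda>_. K). horizontal_strip n f h}"
    using h lower strip upper by (auto simp: shapes_between_def horizontal_strip_def PiE_iff)
qed

text \<open>
  The last summand is the remainder of the first column, the only one whose expansion is infinite.
\<close>

lemma det_add_strip:
  assumes f: "decreasing n f" and K: "\<And>i. 1 \<le> i \<Longrightarrow> i \<le> n \<Longrightarrow> f i \<le> K"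
    and w: "\<And>i. (1 - z i * x l) * w i = 1"
  shows "\<exists>R. (\<Prod>i\<in>{1..n}. u (int i - int (f i)) l * w i) *
      det1 n (\<lambda>i j. double_power c n (z i) (f j + n - j)) =
    (\<Sum>h\<in>shapes_between n f (\<lambda>_. K).
      (if horizontal_strip n f h
       then \<Prod>i\<in>{1..n}. \<Prod>j\<in>{f i<..h i}. x l * v (int i - int j) l else 0) *
      det1 n (\<lambda>i j. double_power c n (z i) (h j + n - j))) +
    (\<Prod>j\<in>{f 1<..Suc K}. x l * v (1 - int j) l) * R"
proof (cases "n = 0")
  case True
  have "shapes_between 0 f (\<lambda>_. K) = {\<lambda>_. undefined}"
    by (auto simp: shapes_between_def decreasing_def)
  then show ?thesis
    using True by (intro exI[of _ 0]) (simp add: horizontal_strip_def det1_def)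
next
  case False
  let ?P = "\<lambda>i. double_power c n (z i)" and ?G = "\<lambda>i. completed n (z i) (w i) l"
  \<comment> \<open>Column j is unfolded up to the measure of column j - 1, where the column
    operation removes the tail. Column 1 has no left neighbour and stops at K + n, the measure of
    length K + 1.\<close>
  let ?r = "\<lambda>j. f j + n - j" and ?r' = "\<lambda>j. if j = 1 then K + n else f (j - 1) + n - (j - 1)"
  let ?H = "\<lambda>j. {f j..if j = 1 then K else f (j - 1)}"
  let ?S = "\<lambda>i j. \<Sum>h\<in>?H j. strip n (?r j) (h + n - j) l * ?P i (h + n - j)"
  let ?s = "strip n (?r 1) (K + n) l"
  have "(\<Prod>i\<in>{1..n}. u (int i - int (f i)) l * w i) * det1 n (\<lambda>i j. ?P i (?r j)) =
      det1 n (\<lambda>i j. w i * (u (int j - int (f j)) l * ?P i (?r j)))"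
    by (simp add: det1_scale_rows det1_scale_columns prod.distrib mult_ac)
  also have "\<dots> = det1 n (\<lambda>i j. ?G i (?r j))"
    by (rule det1_cong) (auto simp: completed_def mult_ac of_nat_diff)
  also have "\<dots> = det1 n (\<lambda>i j. ?G i (?r j) -
      (if j = 1 then 0 else strip n (?r j) (?r (j - 1)) l * ?G i (?r (j - 1))))"
    by (rule det1_add_column_left[symmetric])
  also have "\<dots> = det1 n (\<lambda>i j. ?S i j + (if j = 1 then ?s * ?G i (K + n) else 0))"
  proof (rule det1_cong)
    fix i j assume ij: "1 \<le> i" "i \<le> n" "1 \<le> j" "j \<le> n"
    have "f j \<le> f (j - 1)" if "j \<noteq> 1" using f ij that by (auto simp: decreasing_def)
    moreover have "f 1 \<le> K" using K False by simp
    ultimately have "?r j \<le> ?r' j" using ij by auto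
    then have "?G i (?r j) = (\<Sum>t\<in>{?r j..<?r' j}. strip n (?r j) t l * ?P i t) +
        strip n (?r j) (?r' j) l * ?G i (?r' j)"
      by (rule completed_unfold[OF w])
    also have "(\<Sum>t\<in>{?r j..<?r' j}. strip n (?r j) t l * ?P i t) = ?S i j"
      by (rule sum.reindex_bij_witness[of _ "\<lambda>h. h + n - j" "\<lambda>t. t + j - n"])
        (use ij in \<open>auto split: if_splits\<close>)
    finally show "?G i (?r j) - (if j = 1 then 0 else strip n (?r j) (?r (j - 1)) l * ?G i (?r (j - 1))) =
        ?S i j + (if j = 1 then ?s * ?G i (K + n) else 0)"
      by (cases "j = 1") simp_all
  qed
  also have "\<dots> = det1 n ?S + ?s * det1 n (\<lambda>i j. if j = 1 then ?G i (K + n) else ?S i j)"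
    using False by (intro det1_add_first_column) simp
  also have "det1 n ?S = (\<Sum>h\<in>PiE {1..n} ?H.
      (\<Prod>j\<in>{1..n}. strip n (?r j) (h j + n - j) l) * det1 n (\<lambda>i j. ?P i (h j + n - j)))"
    by (rule det1_sum_columns) simp
  also have "\<dots> = (\<Sum>h\<in>{h \<in> shapes_between n f (\<lambda>_. K). horizontal_strip n f h}.
      (\<Prod>i\<in>{1..n}. \<Prod>j\<in>{f i<..h i}. x l * v (int i - int j) l) *
      det1 n (\<lambda>i j. ?P i (h j + n - j)))"
  proof (rule sum.cong)
    show "PiE {1..n} ?H = {h \<in> shapes_between n f (\<lambda>_. K). horizontal_strip n f h}"
      by (rule horizontal_strips_eq[symmetric]) (use f K in auto)
  next
    fix h
    show "(\<Prod>j\<in>{1..n}. strip n (?r j) (h j + n - j) l) * det1 n (\<lambda>i j. ?P i (h j + n - j)) =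
        (\<Prod>i\<in>{1..n}. \<Prod>j\<in>{f i<..h i}. x l * v (int i - int j) l) *
        det1 n (\<lambda>i j. ?P i (h j + n - j))"
      by (intro arg_cong2[where f = "(*)"] prod.cong refl strip_eq) auto
  qed
  also have "\<dots> = (\<Sum>h\<in>shapes_between n f (\<lambda>_. K).
      (if horizontal_strip n f h
       then \<Prod>i\<in>{1..n}. \<Prod>j\<in>{f i<..h i}. x l * v (int i - int j) l else 0) *
      det1 n (\<lambda>i j. ?P i (h j + n - j)))"
    by (rule sum.mono_neutral_cong_left) auto
  also have "?s = (\<Prod>j\<in>{f 1<..Suc K}. x l * v (1 - int j) l)"
    using strip_eq[of 1 n "f 1" "Suc K" l] False by simp
  finally show ?thesis by blast
qed

text \<open>Passing from \<open>f\<close> to \<open>h\<close> in the factors of the first N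
  variables releases exactly what these variables contribute to the weights of boxes with entry N +
  1.\<close>

lemma weight_telescope:
  assumes le: "\<And>i. 1 \<le> i \<Longrightarrow> i \<le> n \<Longrightarrow> f i \<le> h i"
  shows "(\<Prod>l\<in>{1..N}. \<Prod>i\<in>{1..n}. u (int i - int (f i)) l * w i l) *
      (\<Prod>i\<in>{1..n}. \<Prod>j\<in>{f i<..h i}. x (Suc N) * v (int i - int j) (Suc N)) =
    (\<Prod>l\<in>{1..N}. \<Prod>i\<in>{1..n}. u (int i - int (h i)) l * w i l) *
      (\<Prod>i\<in>{1..n}. \<Prod>j\<in>{f i<..h i}. weight 0 (Suc N) (i, j))"
proof -
  let ?uv = "\<lambda>i j l. u (1 - content (i, j)) l * v (- content (i, j)) l"
  have "{0<..<Suc N} = {1..N}" "{0<..Suc N} = insert (Suc N) {1..N}" by auto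
  then have weight: "weight 0 (Suc N) (i, j) =
      x (Suc N) * v (int i - int j) (Suc N) * (\<Prod>l\<in>{1..N}. ?uv i j l)" for i j
    by (simp add: weight_def content_def prod.distrib mult_ac)
  have row: "u (int i - int (f i)) l = u (int i - int (h i)) l * (\<Prod>j\<in>{f i<..h i}. ?uv i j l)"
    if "i \<in> {1..n}" for i l
    using telescope_row[of "f i" "h i" i l] le that by (simp add: mult.commute)
  have "(\<Prod>l\<in>{1..N}. \<Prod>i\<in>{1..n}. u (int i - int (f i)) l * w i l) =
      (\<Prod>l\<in>{1..N}. \<Prod>i\<in>{1..n}. (u (int i - int (h i)) l * w i l) * (\<Prod>j\<in>{f i<..h i}. ?uv i j l))"
    by (intro prod.cong refl, subst row) (simp_all add: mult_ac)
  also have "\<dots> = (\<Prod>l\<in>{1..N}. \<Prod>i\<in>{1..n}. u (int i - int (h i)) l * w i l) *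
      (\<Prod>l\<in>{1..N}. \<Prod>i\<in>{1..n}. \<Prod>j\<in>{f i<..h i}. ?uv i j l)"
    by (simp only: prod.distrib)
  also have "(\<Prod>l\<in>{1..N}. \<Prod>i\<in>{1..n}. \<Prod>j\<in>{f i<..h i}. ?uv i j l) =
      (\<Prod>i\<in>{1..n}. \<Prod>l\<in>{1..N}. \<Prod>j\<in>{f i<..h i}. ?uv i j l)"
    by (rule prod.swap)
  also have "\<dots> = (\<Prod>i\<in>{1..n}. \<Prod>j\<in>{f i<..h i}. \<Prod>l\<in>{1..N}. ?uv i j l)"
    by (rule prod.cong[OF refl], rule prod.swap)
  finally show ?thesis unfolding weight by (simp only: prod.distrib mult_ac)
qed

end

section \<open>Orders of power series\<close>

definition min_degree :: "nat \<Rightarrow> 'a :: zero mfps \<Rightarrow> bool" where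
  "min_degree e f \<longleftrightarrow> (\<forall>m. mcoeff f m \<noteq> 0 \<longrightarrow> e \<le> mdeg m)"

lemma min_degree_zero_left [simp]: "min_degree 0 f"
  by (simp add: min_degree_def)

lemma min_degree_zero [simp]: "min_degree e 0"
  by (simp add: min_degree_def zero_mfps.rep_eq)

lemma min_degree_mono: "min_degree e f \<Longrightarrow> e' \<le> e \<Longrightarrow> min_degree e' f"
  by (auto simp: min_degree_def intro: order_trans)

lemma min_degree_add: "min_degree e f \<Longrightarrow> min_degree e g \<Longrightarrow> min_degree e (f + g :: 'a :: comm_ring_1 mfps)"
  unfolding min_degree_def plus_mfps.rep_eq by (metis add.right_neutral)

lemma min_degree_sum:
  "(\<And>i. i \<in> A \<Longrightarrow> min_degree e (f i)) \<Longrightarrow> min_degree e (\<Sum>i\<in>A. f i :: 'a :: comm_ring_1 mfps)"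
  by (induction A rule: infinite_finite_induct) (simp_all add: min_degree_add)

lemma min_degree_mult:
  assumes "min_degree e f" "min_degree e' g"
  shows "min_degree (e + e') (f * g :: 'a :: comm_ring_1 mfps)"
  unfolding min_degree_def
proof (intro allI impI)
  fix m assume "mcoeff (f * g) m \<noteq> 0"
  then obtain p q where "(p, q) \<in> splits m" "mcoeff f p * mcoeff g q \<noteq> 0"
    by (auto simp: times_mfps.rep_eq elim!: sum.not_neutral_contains_not_neutral)
  then have "mcoeff f p \<noteq> 0" "mcoeff g q \<noteq> 0" "(p, q) \<in> splits m" by auto
  then have "m = p + q" "e \<le> mdeg p" "e' \<le> mdeg q"
    using assms by (auto simp: splits_def min_degree_def)
  then show "e + e' \<le> mdeg m" by (simp add: mdeg_add)
qed

lemma min_degree_mult_left: "min_degree e f \<Longrightarrow> min_degree e (f * g :: 'a :: comm_ring_1 mfps)"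
  using min_degree_mult[of e f 0 g] by simp

lemma min_degree_mult_right: "min_degree e g \<Longrightarrow> min_degree e (f * g :: 'a :: comm_ring_1 mfps)"
  using min_degree_mult[of 0 f e g] by simp

lemma min_degree_prod:
  "(\<And>i. i \<in> A \<Longrightarrow> min_degree (e i) (f i)) \<Longrightarrow>
    min_degree (\<Sum>i\<in>A. e i) (\<Prod>i\<in>A. f i :: 'a :: comm_ring_1 mfps)"
  by (induction A rule: infinite_finite_induct) (simp_all add: min_degree_mult)

lemma min_degree_mvar: "min_degree 1 (mvar k)"
  by (auto simp: min_degree_def mvar.rep_eq mdeg_def)

lemma min_degree_weight: "min_degree 1 (mfps.weight a p k b)"
  unfolding mfps.weight_def mult.assoc by (rule min_degree_mult_left) (rule min_degree_mvar)

lemma min_degree_tableau_sum: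
  "min_degree (card \<theta>) (tableau_sum (mfps.weight a p) \<theta> A)"
  unfolding tableau_sum_def
proof (rule min_degree_sum)
  fix T
  show "min_degree (card \<theta>) (\<Prod>b\<in>\<theta>. mfps.weight a p (T b) b)"
    unfolding card_eq_sum by (intro min_degree_prod min_degree_weight)
qed

section \<open>The identity with bounded parts and finitely many variables y\<close>

definition cauchy_factor :: "(int \<Rightarrow> 'k :: comm_ring_1) \<Rightarrow> (nat \<Rightarrow> 'k) \<Rightarrow> nat \<Rightarrow> (nat \<Rightarrow> nat) \<Rightarrow> nat \<Rightarrow> 'k mfps" where
  "cauchy_factor a x n f l = (\<Prod>i\<in>{1..n}. mfps.u a (int i - int (f i)) l * mgeom (x i) l)"

text \<open>Without the Vandermonde denominator the identity makes sense over any commutative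
  ring.\<close>

definition numerator :: "(int \<Rightarrow> 'k :: comm_ring_1) \<Rightarrow> (nat \<Rightarrow> 'k) \<Rightarrow> nat \<Rightarrow> (nat \<Rightarrow> nat) \<Rightarrow> 'k mfps" where
  "numerator a x n f =
    det1 n (\<lambda>i j. double_power (\<lambda>k. mconst (a k)) n (mconst (x i)) (f j + n - j))"

lemma numerator_cong:
  assumes "\<And>i. 1 \<le> i \<Longrightarrow> i \<le> n \<Longrightarrow> f i = g i"
  shows "numerator a x n f = numerator a x n g"
  unfolding numerator_def by (rule det1_cong) (simp add: assms)

text \<open>Without entries only the empty skew shape has a tableau; \<open>f\<close> is restricted
  because the summation indices are extensional.\<close>

lemma cauchy_no_variables:
  assumes f: "decreasing n f" and K: "\<And>i. 1 \<le> i \<Longrightarrow> i \<le> n \<Longrightarrow> f i \<le> K"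
  shows "(\<Sum>h\<in>shapes_between n f (\<lambda>_. K).
    numerator a x n h * tableau_sum w (shape n h - shape n f) {}) = numerator a x n f"
proof -
  let ?f = "restrict f {1..n}"
  have mem: "?f \<in> shapes_between n f (\<lambda>_. K)"
    using f K by (auto simp: shapes_between_def decreasing_def)
  have "tableau_sum w (shape n h - shape n f) {} = 0"
    if h: "h \<in> shapes_between n f (\<lambda>_. K)" "h \<noteq> ?f" for h
  proof (rule tableau_sum_no_values, rule notI)
    assume empty: "shape n h - shape n f = {}"
    have "h i = f i" if i: "1 \<le> i" "i \<le> n" for i
    proof -
      have "f i \<le> h i" using h i by (auto simp: shapes_between_def PiE_iff)
      moreover have "(i, h i) \<notin> shape n h - shape n f" unfolding empty by simp
      ultimately show ?thesis using i by (auto simp: shape_diff)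
    qed
    then have "h = ?f"
      using h by (intro PiE_ext[of h "{1..n}" _ ?f]) (auto simp: shapes_between_def)
    then show False using h by simp
  qed
  then have "(\<Sum>h\<in>shapes_between n f (\<lambda>_. K).
      numerator a x n h * tableau_sum w (shape n h - shape n f) {}) =
      (\<Sum>h\<in>{?f}. numerator a x n h * tableau_sum w (shape n h - shape n f) {})"
    by (intro sum.mono_neutral_right) (use mem in auto)
  also have "shape n ?f = shape n f" "numerator a x n ?f = numerator a x n f"
    by (rule shape_cong numerator_cong; simp)+
  then have "(\<Sum>h\<in>{?f}. numerator a x n h * tableau_sum w (shape n h - shape n f) {}) = numerator a x n f"
    by (simp add: tableau_sum_empty)
  finally show ?thesis .
qed

text \<open>Variable N + 1 adds to \<open>f\<close> the inner strip of entries N + 1; the other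
  variables act on the enlarged shape by induction. The order of the error is the number of boxes
  that extend the first row to length K + 1.\<close>

lemma cauchy_finite:
  fixes a :: "int \<Rightarrow> 'k :: comm_ring_1"
  assumes n: "1 \<le> n"
    and "decreasing n f" "\<And>i. 1 \<le> i \<Longrightarrow> i \<le> n \<Longrightarrow> f i \<le> K"
  shows "min_degree (Suc K - f 1)
    ((\<Prod>l\<in>{1..N}. cauchy_factor a x n f l) * numerator a x n f -
      (\<Sum>h\<in>shapes_between n f (\<lambda>_. K).
        numerator a x n h * tableau_sum (mfps.weight a 0) (shape n h - shape n f) {1..N}))"
  using assms(2,3)
proof (induction N arbitrary: f)
  case 0
  then show ?case by (simp add: cauchy_no_variables)
next
  case (Suc N)
  let ?F = "\<lambda>f. \<Prod>l\<in>{1..N}. cauchy_factor a x n f l" and ?D = "numerator a x n"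
  let ?B = "shapes_between n f (\<lambda>_. K)"
  let ?ts = "\<lambda>h f. tableau_sum (mfps.weight a 0) (shape n h - shape n f)"
  let ?E = "\<lambda>h. ?F h * ?D h - (\<Sum>g\<in>shapes_between n h (\<lambda>_. K). ?D g * ?ts g h {1..N})"
  let ?x = "mvar (Suc N) :: 'k mfps" and ?v = "\<lambda>k. mgeom (a k) (Suc N)"
  define W where "W h = (if horizontal_strip n f h
    then \<Prod>i\<in>{1..n}. \<Prod>j\<in>{f i<..h i}. mfps.weight a 0 (Suc N) (i, j) else 0)" for h
  have B: "decreasing n h" "f i \<le> h i" "h i \<le> K" if "h \<in> ?B" "1 \<le> i" "i \<le> n" for h i
    using that by (auto simp: shapes_between_def PiE_iff)
  obtain R where R: "cauchy_factor a x n f (Suc N) * ?D f =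
    (\<Sum>h\<in>?B. (if horizontal_strip n f h
       then \<Prod>i\<in>{1..n}. \<Prod>j\<in>{f i<..h i}. ?x * ?v (int i - int j) else 0) * ?D h) +
    (\<Prod>j\<in>{f 1<..Suc K}. ?x * ?v (1 - int j)) * R"
    using mfps.det_add_strip[where a = a and z = "\<lambda>i. mconst (x i)" and l = "Suc N"
        and w = "\<lambda>i. mgeom (x i) (Suc N)", OF Suc.prems mgeom_eq]
    unfolding cauchy_factor_def numerator_def by blast
  let ?Q = "\<Prod>j\<in>{f 1<..Suc K}. ?x * ?v (1 - int j)"
  have W: "?F f * (if horizontal_strip n f h
      then \<Prod>i\<in>{1..n}. \<Prod>j\<in>{f i<..h i}. ?x * ?v (int i - int j) else 0) = W h * ?F h"
    if "h \<in> ?B" for h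
    using mfps.weight_telescope[of n f h a "\<lambda>i l. mgeom (x i) l" N] B(2)[OF that]
    by (simp add: W_def cauchy_factor_def mult.commute)
  have "(\<Prod>l\<in>{1..Suc N}. cauchy_factor a x n f l) * ?D f =
      ?F f * (cauchy_factor a x n f (Suc N) * ?D f)"
    by (simp add: mult_ac)
  also have "\<dots> = (\<Sum>h\<in>?B. W h * (?F h * ?D h)) + ?Q * (?F f * R)"
    unfolding R distrib_left sum_distrib_left
    by (intro arg_cong2[where f = "(+)"] sum.cong refl)
      (simp_all only: W mult.assoc[symmetric], simp only: mult_ac)
  finally have lhs: "(\<Prod>l\<in>{1..Suc N}. cauchy_factor a x n f l) * ?D f =
      (\<Sum>h\<in>?B. W h * (?F h * ?D h)) + ?Q * (?F f * R)" .
  have "(\<Sum>g\<in>?B. ?D g * ?ts g f {1..Suc N}) =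
      (\<Sum>g\<in>?B. \<Sum>h\<in>{h \<in> ?B. \<forall>i\<in>{1..n}. h i \<le> g i}. W h * (?D g * ?ts g h {1..N}))"
  proof (rule sum.cong)
    fix g assume g: "g \<in> ?B"
    have "{1..Suc N} = insert (Suc N) {1..N}" by auto
    moreover have "?ts g f (insert (Suc N) {1..N}) = (\<Sum>h\<in>shapes_between n f g. W h * ?ts g h {1..N})"
      unfolding W_def by (rule tableau_sum_insert_largest) (use Suc.prems B[OF g] n in auto)
    moreover have "shapes_between n f g = {h \<in> ?B. \<forall>i\<in>{1..n}. h i \<le> g i}"
      using g by (fastforce simp: shapes_between_def PiE_iff)
    ultimately show "?D g * ?ts g f {1..Suc N} =
        (\<Sum>h\<in>{h \<in> ?B. \<forall>i\<in>{1..n}. h i \<le> g i}. W h * (?D g * ?ts g h {1..N}))"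
      by (simp only: sum_distrib_left mult_ac)
  qed simp
  \<comment> \<open>Exchanges the sums over chains f \<le> h \<le> g, so that for fixed
    \<open>h\<close> the sum of the induction hypothesis appears.\<close>
  also have "\<dots> = (\<Sum>h\<in>?B. \<Sum>g\<in>{g \<in> ?B. \<forall>i\<in>{1..n}. h i \<le> g i}. W h * (?D g * ?ts g h {1..N}))"
    by (rule sum.swap_restrict) simp_all
  also have "\<dots> = (\<Sum>h\<in>?B. W h * (\<Sum>g\<in>shapes_between n h (\<lambda>_. K). ?D g * ?ts g h {1..N}))"
  proof (rule sum.cong)
    fix h assume h: "h \<in> ?B"
    have "shapes_between n h (\<lambda>_. K) = {g \<in> ?B. \<forall>i\<in>{1..n}. h i \<le> g i}"
      using h by (fastforce simp: shapes_between_def PiE_iff)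
    then show "(\<Sum>g\<in>{g \<in> ?B. \<forall>i\<in>{1..n}. h i \<le> g i}. W h * (?D g * ?ts g h {1..N})) =
        W h * (\<Sum>g\<in>shapes_between n h (\<lambda>_. K). ?D g * ?ts g h {1..N})"
      by (simp only: sum_distrib_left)
  qed simp
  finally have diff: "(\<Prod>l\<in>{1..Suc N}. cauchy_factor a x n f l) * ?D f - (\<Sum>g\<in>?B. ?D g * ?ts g f {1..Suc N}) =
      (\<Sum>h\<in>?B. W h * ?E h) + ?Q * (?F f * R)"
    unfolding lhs by (simp add: right_diff_distrib sum_subtractf)
  \<comment> \<open>\<open>W h\<close> has at least the order h_1 - f_1 of the boxes added to the
    first row, and the inductive error has order K + 1 - h_1.\<close>
  have err: "min_degree (Suc K - f 1) (W h * ?E h)" if h: "h \<in> ?B" for h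
  proof -
    have "min_degree (Suc K - h 1) (?E h)"
      using B[OF h] n by (intro Suc.IH) auto
    moreover have "min_degree (h 1 - f 1) (W h)"
    proof (cases "horizontal_strip n f h")
      case True
      have "min_degree (\<Sum>i\<in>{1..n}. \<Sum>j\<in>{f i<..h i}. 1) (W h)"
        unfolding W_def using True by (simp only: if_True) (intro min_degree_prod min_degree_weight)
      moreover have "h 1 - f 1 \<le> (\<Sum>i\<in>{1..n}. h i - f i)"
        by (rule member_le_sum[of 1]) (use n in auto)
      ultimately show ?thesis by (auto intro: min_degree_mono)
    qed (simp add: W_def)
    ultimately have "min_degree (h 1 - f 1 + (Suc K - h 1)) (W h * ?E h)"
      by (intro min_degree_mult)
    then show ?thesis by (rule min_degree_mono) simp
  qed
  \<comment> \<open>One factor \<open>?x\<close> for each column from f_1 + 1 to K + 1.\<close>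
  have rem: "min_degree (Suc K - f 1) ?Q"
    using min_degree_prod[of "{f 1<..Suc K}" "\<lambda>_. 1" "\<lambda>j. ?x * ?v (1 - int j)"]
    by (simp add: min_degree_mult_left min_degree_mvar del: One_nat_def)
  show ?case
    unfolding diff by (rule min_degree_add[OF min_degree_sum[OF err] min_degree_mult_left[OF rem]])
qed

section \<open>The Cauchy identity\<close>

text \<open>Monomials in the variables up to n are not affected by the factors from index n on, so
  each coefficient of the partial products is eventually constant.\<close>

lemma has_prod_mfps:
  fixes f :: "nat \<Rightarrow> 'a :: idom mfps"
  assumes f: "\<And>n j. n \<le> j \<Longrightarrow> truncate_vars n (f j) = 1"
  shows "\<exists>P. f has_prod P \<and> (\<forall>n. truncate_vars n P = truncate_vars n (\<Prod>j<n. f j))"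
proof -
  let ?k = "\<lambda>(m :: nat \<Rightarrow>\<^sub>0 nat) n. Poly_Mapping.keys m \<subseteq> {..n :: nat}"
  have stable: "mcoeff (\<Prod>j<q. f j) m = mcoeff (\<Prod>j<n. f j) m" if "?k m n" "n \<le> q" for m n q
  proof -
    have "(\<Prod>j<q. truncate_vars n (f j)) = (\<Prod>j<n. truncate_vars n (f j))"
      by (rule prod.mono_neutral_right) (use that f in auto)
    then have "truncate_vars n (\<Prod>j<q. f j) = truncate_vars n (\<Prod>j<n. f j)"
      by (simp add: truncate_vars_prod)
    then show ?thesis using that by (metis mcoeff_truncate_vars)
  qed
  have "\<exists>n. ?k m n" for m
    using finite_nat_set_iff_bounded_le[of "Poly_Mapping.keys m"] by auto
  then obtain B where B: "?k m (B m)" for m by metis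
  define P where "P = Abs_mfps (\<lambda>m. mcoeff (\<Prod>j<B m. f j) m)"
  have P: "mcoeff P m = mcoeff (\<Prod>j<q. f j) m" if "?k m n" "n \<le> q" for m n q
    using stable[OF that] stable[OF that(1), where q = "max n (B m)"] stable[OF B, where q = "max n (B m)"]
    by (simp add: P_def Abs_mfps_inverse)
  have "(\<lambda>n. \<Prod>i\<le>n. f (i + 0)) \<longlonglongrightarrow> P"
  proof (rule topological_tendstoI)
    fix U assume "open U" "P \<in> U"
    then obtain M where M: "finite M" "\<forall>g. (\<forall>m\<in>M. mcoeff g m = mcoeff P m) \<longrightarrow> g \<in> U"
      unfolding open_mfps_def by blast
    have "(\<Prod>i\<le>n. f (i + 0)) \<in> U" if n: "Max (insert 0 (B ` M)) \<le> n" for n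
    proof -
      have "mcoeff (\<Prod>i\<le>n. f (i + 0)) m = mcoeff P m" if m: "m \<in> M" for m
      proof -
        have "B m \<le> n" using n m M(1) by simp
        then have "B m \<le> Suc n" by simp
        then show ?thesis using P[OF B[of m], where q = "Suc n"] by (simp add: lessThan_Suc_atMost)
      qed
      then show ?thesis using M(2) by blast
    qed
    then show "\<forall>\<^sub>F n in sequentially. (\<Prod>i\<le>n. f (i + 0)) \<in> U"
      unfolding eventually_sequentially by blast
  qed
  \<comment> \<open>\<open>has_prod\<close> asks for a nonzero limit; the constant coefficient is
    1.\<close>
  moreover have "P \<noteq> 0"
    using P[where m = 0 and n = 0 and q = 0] by (auto simp: one_mfps.rep_eq zero_mfps.rep_eq)
  ultimately have "f has_prod P"
    unfolding has_prod_def raw_has_prod_def by blast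
  moreover have "truncate_vars n P = truncate_vars n (\<Prod>j<n. f j)" for n
    by (rule mfps_eqI) (simp add: truncate_vars.rep_eq P[where n = n and q = n])
  ultimately show ?thesis by blast
qed

lemma truncate_vars_prodinf:
  fixes f :: "nat \<Rightarrow> 'a :: idom mfps"
  assumes "\<And>n j. n \<le> j \<Longrightarrow> truncate_vars n (f j) = 1"
  shows "truncate_vars n (prodinf f) = truncate_vars n (\<Prod>j<n. f j)"
proof -
  obtain P where P: "f has_prod P" "truncate_vars n P = truncate_vars n (\<Prod>j<n. f j)" for n
    using has_prod_mfps[of f, OF assms] by blast
  then show ?thesis using has_prod_unique[OF P(1)] by simp
qed

text \<open>Factor j belongs to variable j + 1, so it becomes 1 under truncation to at most j
  variables.\<close>

lemma truncate_vars_cauchy_product: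
  fixes a :: "int \<Rightarrow> 'k :: idom"
  shows "truncate_vars N (\<Prod>i\<in>{1..n}. prodinf (\<lambda>j.
      (1 - mconst (a (int i - int (f i))) * mvar (Suc j)) / (1 - mconst (x i) * mvar (Suc j)))) =
    (\<Prod>l\<in>{1..N}. cauchy_factor a x n f l)"
proof -
  let ?f = "\<lambda>i j. (1 - mconst (a (int i - int (f i))) * mvar (Suc j)) / (1 - mconst (x i) * mvar (Suc j))"
  let ?g = "\<lambda>i l. mfps.u a (int i - int (f i)) l * mgeom (x i) l"
  have f: "?f i j = ?g i (Suc j)" for i j
    by (simp add: divide_mfps_def inverse_one_minus_var mfps.u_def)
  have g: "truncate_vars N (?g i l) = (if l \<le> N then ?g i l else 1)" for N i l
    by (simp add: mfps.u_def truncate_vars_mult truncate_vars_diff truncate_vars_mvar truncate_vars_mgeom)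
  have "truncate_vars N (prodinf (?f i)) = (\<Prod>l\<in>{1..N}. ?g i l)" for i
  proof -
    have "truncate_vars N (prodinf (?f i)) = truncate_vars N (\<Prod>j<N. ?f i j)"
      by (rule truncate_vars_prodinf) (simp only: f g Suc_n_not_le_n, simp)
    also have "\<dots> = (\<Prod>j<N. ?g i (Suc j))"
      unfolding truncate_vars_prod f g by (rule prod.cong) auto
    also have "\<dots> = (\<Prod>l\<in>{1..N}. ?g i l)"
      by (rule prod.reindex_bij_witness[of _ "\<lambda>j. j - 1" Suc]) auto
    finally show ?thesis .
  qed
  then have "truncate_vars N (\<Prod>i\<in>{1..n}. prodinf (?f i)) = (\<Prod>i\<in>{1..n}. \<Prod>l\<in>{1..N}. ?g i l)"
    unfolding truncate_vars_prod by simp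
  also have "\<dots> = (\<Prod>l\<in>{1..N}. cauchy_factor a x n f l)"
    unfolding cauchy_factor_def by (rule prod.swap)
  finally show ?thesis .
qed

interpretation mconst: comm_ring_hom "mconst :: 'a :: comm_ring_1 \<Rightarrow> 'a mfps"
  by unfold_locales (simp_all add: mconst_add mconst_mult)

lemma mconst_det1: "mconst (det1 n A) = det1 n (\<lambda>i j. mconst (A i j :: 'a :: comm_ring_1))"
proof -
  have "map_mat mconst (Matrix.mat n n (\<lambda>(i, j). A (Suc i) (Suc j))) =
      Matrix.mat n n (\<lambda>(i, j). mconst (A (Suc i) (Suc j)))"
    by (rule eq_matI) auto
  then show ?thesis unfolding det1_def by (simp flip: mconst.hom_det)
qed

lemma mconst_double_power:
  "mconst (double_power a n z r) = double_power (\<lambda>k. mconst (a k)) n (mconst (z :: 'a :: comm_ring_1)) r"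
  unfolding double_power_def by (induction r) (simp_all add: mconst_mult mconst_diff)

lemma numerator_eq:
  "numerator a x n f = mconst (det1 n (\<lambda>i j. double_power a n (x i) (f j + n - j)))"
  by (simp add: numerator_def mconst_det1 mconst_double_power)

lemma mconst_double_schur:
  assumes "length lam \<le> n"
  shows "mconst (double_schur a n x lam) =
    mconst (inverse (vandermonde n x)) * numerator a x n (part lam)"
  using assms
  by (simp add: double_schur_def numerator_eq divide_inverse mconst_mult mult.commute)

section \<open>Partitions as lists and as row-length functions\<close>

lemma partition_exists:
  "decreasing n h \<Longrightarrow> \<exists>lam. is_partition lam \<and> length lam \<le> n \<and> (\<forall>i\<in>{1..n}. part lam i = h i)"
proof (induction n)
  case 0
  show ?case by (intro exI[of _ "[]"]) (simp add: is_partition_def)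
next
  case (Suc n)
  show ?case
  \<comment> \<open>Lists of parts contain no zeros: a zero last row is dropped, and a nonzero one
    makes all rows positive.\<close>
  proof (cases "h (Suc n) = 0")
    case True
    obtain lam where lam: "is_partition lam" "length lam \<le> n" "\<forall>i\<in>{1..n}. part lam i = h i"
      using Suc by (auto simp: decreasing_def)
    then have "part lam (Suc n) = h (Suc n)" using True by (simp add: part_def)
    then have "\<forall>i\<in>{1..Suc n}. part lam i = h i"
      using lam(3) by (auto simp: le_Suc_eq)
    then show ?thesis using lam by (intro exI[of _ lam]) simp
  next
    case False
    let ?lam = "map h [1..<Suc (Suc n)]"
    have pos: "0 < h i" if "1 \<le> i" "i \<le> Suc n" for i
    proof -
      have "h (Suc n) \<le> h i" using Suc.prems that by (auto simp: decreasing_def)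
      then show ?thesis using False by simp
    qed
    have "is_partition ?lam"
      unfolding is_partition_def
    proof
      show "sorted_wrt (\<ge>) ?lam"
        unfolding sorted_wrt_iff_nth_less using Suc.prems by (auto simp: decreasing_def simp del: upt_Suc)
      show "0 \<notin> set ?lam" using pos by (force simp del: upt_Suc)
    qed
    moreover have "part ?lam i = h i" if "i \<in> {1..Suc n}" for i
      using that by (auto simp: part_def simp del: upt_Suc)
    ultimately show ?thesis by (intro exI[of _ ?lam]) (simp del: upt_Suc)
  qed
qed

lemma partition_eqI:
  assumes "is_partition lam" "is_partition lam'" "length lam \<le> n" "length lam' \<le> n"
    and eq: "\<And>i. 1 \<le> i \<Longrightarrow> i \<le> n \<Longrightarrow> part lam i = part lam' i"
  shows "lam = lam'"
proof -
  have le: "length l' \<le> length l" if "is_partition l'" "length l' \<le> n"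
    "\<And>i. 1 \<le> i \<Longrightarrow> i \<le> n \<Longrightarrow> part l' i = part l i" for l l'
  proof (rule ccontr)
    assume "\<not> length l' \<le> length l"
    then have "1 \<le> length l'" by simp
    then have "1 \<le> part l' (length l')" by (intro part_pos that(1)) simp_all
    moreover have "part l (length l') = 0" using \<open>\<not> length l' \<le> length l\<close> by (simp add: part_def)
    ultimately show False using that(2) that(3)[of "length l'"] \<open>\<not> length l' \<le> length l\<close> by simp
  qed
  have len: "length lam = length lam'"
    using assms by (intro antisym le) simp_all
  show ?thesis
  proof (rule nth_equalityI[OF len])
    fix i assume "i < length lam"
    then show "lam ! i = lam' ! i"
      using eq[of "Suc i"] len assms by (simp add: part_def)
  qed
qed

lemma diagram_subset_iff: "diagram mu \<subseteq> diagram nu \<longleftrightarrow> (\<forall>i\<ge>1. part mu i \<le> part nu i)"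
proof
  assume sub: "diagram mu \<subseteq> diagram nu"
  show "\<forall>i\<ge>1. part mu i \<le> part nu i"
  proof (intro allI impI)
    fix i :: nat assume "1 \<le> i"
    then show "part mu i \<le> part nu i"
      using sub[THEN subsetD, of "(i, part mu i)"] by (cases "part mu i = 0") (auto simp: diagram_def)
  qed
qed (auto simp: diagram_def intro: order_trans)

text \<open>The bound on the first part bounds all parts, so the partitions correspond to a finite
  set of shapes.\<close>

lemma bij_betw_partitions:
  assumes mu: "length mu \<le> n"
  shows "bij_betw (\<lambda>nu. restrict (part nu) {1..n})
    {nu. is_partition nu \<and> length nu \<le> n \<and> diagram mu \<subseteq> diagram nu \<and> part nu 1 \<le> K}
    (shapes_between n (part mu) (\<lambda>_. K))"
proof (rule bij_betwI')
  fix nu nu'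
  assume nu: "nu \<in> {nu. is_partition nu \<and> length nu \<le> n \<and> diagram mu \<subseteq> diagram nu \<and> part nu 1 \<le> K}"
    "nu' \<in> {nu. is_partition nu \<and> length nu \<le> n \<and> diagram mu \<subseteq> diagram nu \<and> part nu 1 \<le> K}"
  show "restrict (part nu) {1..n} = restrict (part nu') {1..n} \<longleftrightarrow> nu = nu'"
  proof
    assume eq: "restrict (part nu) {1..n} = restrict (part nu') {1..n}"
    have "part nu i = part nu' i" if "1 \<le> i" "i \<le> n" for i
      using fun_cong[OF eq, of i] that by simp
    then show "nu = nu'" using nu by (intro partition_eqI[of nu nu' n]) auto
  qed simp
next
  fix nu
  assume nu: "nu \<in> {nu. is_partition nu \<and> length nu \<le> n \<and> diagram mu \<subseteq> diagram nu \<and> part nu 1 \<le> K}"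
  have "part nu i \<le> K" if "1 \<le> i" for i
    using nu that part_antimono[of nu 1 i] by auto
  then show "restrict (part nu) {1..n} \<in> shapes_between n (part mu) (\<lambda>_. K)"
    using nu by (auto simp: shapes_between_def diagram_subset_iff decreasing_def part_antimono)
next
  fix h assume h: "h \<in> shapes_between n (part mu) (\<lambda>_. K)"
  then obtain nu where nu: "is_partition nu" "length nu \<le> n" "\<forall>i\<in>{1..n}. part nu i = h i"
    using partition_exists[of n h] by (auto simp: shapes_between_def)
  have "part mu i \<le> part nu i" if "1 \<le> i" for i
    using h nu(3) that mu by (cases "i \<le> n") (auto simp: shapes_between_def PiE_iff part_def)
  moreover have "part nu 1 \<le> K"
    using h nu by (cases "n = 0") (auto simp: shapes_between_def PiE_iff part_def)
  moreover have "h = restrict (part nu) {1..n}"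
    using h nu(3) by (intro PiE_ext[of h "{1..n}" _ "restrict (part nu) {1..n}"]) (auto simp: shapes_between_def PiE_iff)
  ultimately show "\<exists>nu\<in>{nu. is_partition nu \<and> length nu \<le> n \<and> diagram mu \<subseteq> diagram nu \<and> part nu 1 \<le> K}.
      h = restrict (part nu) {1..n}"
    using nu by (auto simp: diagram_subset_iff)
qed

text \<open>Proved for one monomial \<open>m\<close> at a time: after truncation to finitely many
  variables including those of \<open>m\<close>, \<open>cauchy_finite\<close> applies, and the
  Vandermonde inverse is a common constant factor.\<close>

theorem cauchy_identity:
  fixes a :: "int \<Rightarrow> 'k :: field"
  assumes mu: "is_partition mu" "length mu \<le> n"
  shows "((\<lambda>nu. mconst (double_schur a n x nu) * skew_dual_schur a (diagram nu - diagram mu)) has_sum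
      ((\<Prod>i\<in>{1..n}. prodinf (\<lambda>j. (1 - mconst (a (int i - int (part mu i))) * mvar (Suc j)) /
          (1 - mconst (x i) * mvar (Suc j)))) * mconst (double_schur a n x mu)))
    {nu. is_partition nu \<and> diagram mu \<subseteq> diagram nu}"
    (is "((\<lambda>nu. ?t nu) has_sum ?L * _) ?A")
proof (rule has_sum_mfpsI)
  fix m :: "nat \<Rightarrow>\<^sub>0 nat"
  let ?f = "part mu" and ?d = "mconst (inverse (vandermonde n x))" and ?w = "mfps.weight a 0"
  \<comment> \<open>Partitions with a larger first part contribute only in degrees above that of
    \<open>m\<close>, and the error in \<open>cauchy_finite\<close> has order
    \<open>mdeg m + 1\<close>.\<close>
  define K where "K = part mu 1 + mdeg m"
  let ?X = "{nu. is_partition nu \<and> length nu \<le> n \<and> diagram mu \<subseteq> diagram nu \<and> part nu 1 \<le> K}"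
  let ?B = "shapes_between n ?f (\<lambda>_. K)"
  obtain N where N: "Poly_Mapping.keys m \<subseteq> {..N}"
    using finite_nat_set_iff_bounded_le[of "Poly_Mapping.keys m"] by auto
  let ?s = "\<lambda>h. numerator a x n h * tableau_sum ?w (shape n h - shape n ?f) {1..N}"
  have bij: "bij_betw (\<lambda>nu. restrict (part nu) {1..n}) ?X ?B"
    by (rule bij_betw_partitions[OF mu(2)])
  have K: "?f i \<le> K" if "1 \<le> i" for i
    using part_antimono[OF mu(1) _ that] by (simp add: K_def)
  have skew: "truncate_vars N (skew_dual_schur a (diagram nu - diagram mu)) =
      tableau_sum ?w (shape n (part nu) - shape n ?f) {1..N}" if "length nu \<le> n" for nu
    using that mu(2)
    by (simp add: truncate_vars_skew_dual_schur finite_diagram diagram_eq_shape box_weight_eq)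
  have t: "truncate_vars N (?t nu) = ?d * ?s (part nu)" if "length nu \<le> n" for nu
    using that by (simp add: truncate_vars_mult skew mconst_double_schur numerator_eq mult.assoc)
  have "finite ?X" using bij bij_betw_finite finite_shapes_between by blast
  moreover have "?X \<subseteq> ?A" by auto
  moreover have "{nu \<in> ?A. mcoeff (?t nu) m \<noteq> 0} \<subseteq> ?X"
  proof
    fix nu assume nu: "nu \<in> {nu \<in> ?A. mcoeff (?t nu) m \<noteq> 0}"
    \<comment> \<open>With more than \<open>n\<close> rows the double Schur function is 0 by
      definition.\<close>
    have len: "length nu \<le> n"
    proof (rule ccontr)
      assume "\<not> length nu \<le> n"
      then have "mcoeff (?t nu) m = 0" by (simp add: double_schur_def zero_mfps.rep_eq)
      then show False using nu by simp
    qed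
    let ?\<theta> = "shape n (part nu) - shape n ?f"
    have "mcoeff (?d * ?s (part nu)) m \<noteq> 0"
      using nu N t[OF len] by (metis (mono_tags, lifting) mcoeff_truncate_vars mem_Collect_eq)
    moreover have "min_degree (card ?\<theta>) (?d * ?s (part nu))"
      by (intro min_degree_mult_right min_degree_tableau_sum)
    ultimately have "card ?\<theta> \<le> mdeg m" by (simp add: min_degree_def)
    moreover have "part nu 1 - ?f 1 \<le> card ?\<theta>"
    proof (cases "n = 0")
      case False
      have "Pair 1 ` {?f 1<..part nu 1} \<subseteq> ?\<theta>" using False by (auto simp: shape_diff)
      then have "card (Pair (1 :: nat) ` {?f 1<..part nu 1}) \<le> card ?\<theta>"
        by (intro card_mono) auto
      then show ?thesis by (simp add: card_image inj_on_def)
    qed (use len in \<open>simp add: part_def\<close>)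
    ultimately have "part nu 1 \<le> K" by (simp add: K_def)
    then show "nu \<in> ?X" using nu len by simp
  qed
  moreover have "mcoeff (?L * mconst (double_schur a n x mu)) m = (\<Sum>nu\<in>?X. mcoeff (?t nu) m)"
  proof -
    let ?P = "(\<Prod>l\<in>{1..N}. cauchy_factor a x n ?f l) * numerator a x n ?f"
    have "mcoeff ?P m = mcoeff (\<Sum>h\<in>?B. ?s h) m"
    \<comment> \<open>\<open>cauchy_finite\<close> measures its error by the first row, so the case
      without rows is separate.\<close>
    proof (cases "n = 0")
      case True
      have "?B = {\<lambda>_. undefined}"
        using True by (auto simp: shapes_between_def decreasing_def)
      then show ?thesis
        using True by (simp add: cauchy_factor_def shape_def tableau_sum_empty numerator_def det1_def)
    next
      case False
      have "min_degree (Suc K - ?f 1) (?P - (\<Sum>h\<in>?B. ?s h))"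
        by (rule cauchy_finite) (use False K mu in \<open>auto simp: decreasing_part\<close>)
      then have "mcoeff (?P - (\<Sum>h\<in>?B. ?s h)) m = 0"
        by (auto simp: min_degree_def K_def Suc_diff_le)
      then show ?thesis by (simp add: minus_mfps.rep_eq)
    qed
    then have "mcoeff (?d * ?P) m = mcoeff (?d * (\<Sum>h\<in>?B. ?s h)) m"
      by (simp add: mcoeff_const_mult)
    also have "\<dots> = (\<Sum>h\<in>?B. mcoeff (?d * ?s h) m)"
      by (simp add: sum_distrib_left mcoeff_sum)
    also have "\<dots> = (\<Sum>nu\<in>?X. mcoeff (?d * ?s (restrict (part nu) {1..n})) m)"
      by (rule sum.reindex_bij_betw[OF bij, symmetric])
    also have "\<dots> = (\<Sum>nu\<in>?X. mcoeff (?t nu) m)"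
    proof (rule sum.cong)
      fix nu assume "nu \<in> ?X"
      then have len: "length nu \<le> n" by simp
      have "numerator a x n (restrict (part nu) {1..n}) = numerator a x n (part nu)"
        "shape n (restrict (part nu) {1..n}) = shape n (part nu)"
        by (rule numerator_cong shape_cong; simp)+
      then have "?d * ?s (restrict (part nu) {1..n}) = truncate_vars N (?t nu)"
        by (simp only: t[OF len])
      then show "mcoeff (?d * ?s (restrict (part nu) {1..n})) m = mcoeff (?t nu) m"
        using N by (simp only: mcoeff_truncate_vars)
    qed simp
    finally have "(\<Sum>nu\<in>?X. mcoeff (?t nu) m) = mcoeff (?d * ?P) m" ..
    moreover have "?d * ?P = truncate_vars N (?L * mconst (double_schur a n x mu))"
      unfolding truncate_vars_mult truncate_vars_cauchy_product truncate_vars_mconst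
        mconst_double_schur[OF mu(2)] numerator_eq
      by (simp only: mult_ac)
    ultimately show ?thesis using N by (simp only: mcoeff_truncate_vars)
  qed
  ultimately show "\<exists>X. finite X \<and> X \<subseteq> ?A \<and> {nu \<in> ?A. mcoeff (?t nu) m \<noteq> 0} \<subseteq> X \<and>
      mcoeff (?L * mconst (double_schur a n x mu)) m = (\<Sum>nu\<in>X. mcoeff (?t nu) m)"
    by blast
qed

theorem theorem3p4:
  "(\<forall>\<mu> n. is_partition \<mu> \<and> length \<mu> \<le> n \<longrightarrow>
      ((\<lambda>\<nu>. mconst (double_schur avar_frac n xvar_frac \<nu>) *
            skew_dual_schur avar_frac (diagram \<nu> - diagram \<mu>))
        has_sum
        ((\<Prod>i\<in>{1..n}. prodinf (\<lambda>j.
            (1 - mconst (avar_frac (int i - int (part \<mu> i))) * mvar (Suc j)) /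
            (1 - mconst (xvar_frac i) * mvar (Suc j)))) *
          mconst (double_schur avar_frac n xvar_frac \<mu>)))
      {\<nu>. is_partition \<nu> \<and> diagram \<mu> \<subseteq> diagram \<nu>}) \<and>
   (\<forall>lam. is_partition lam \<longrightarrow>
      (tableau_weight avar (diagram lam) has_sum dual_schur avar lam)
        (reverse_tableaux (diagram lam)))"
proof (intro conjI allI impI; (elim conjE)?)
  fix lam assume lam: "is_partition lam"
  show "(tableau_weight avar (diagram lam) has_sum dual_schur avar lam) (reverse_tableaux (diagram lam))"
    unfolding dual_schur_eq_tableaux[OF lam] skew_dual_schur_def
    by (intro has_sum_infsum tableau_weight_summable finite_diagram)
qed (rule cauchy_identity)

end
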